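(* Consider a space-time DGSEM solution $\{\mathbf U^{n,k}\}_{1\le n\le K_T,\,1\le k\le K_S}$ (as defined in the context) with Dirichlet boundary conditions in time, given by initial nodal data $\mathbf u^{1,k}_{ijk}=\mathbf u^k(0)_{ijk}$, and periodic boundary conditions in space. Assume that the temporal numerical states $\mathbf U^{*}$ (one single-valued state at each temporal interface, used by both adjacent elements) satisfy $$\mathbf U^{1,k,*}|_{\tau=-1}=\mathbf u^{1,k},\qquad \mathbf U^{K_T,k,*}|_{\tau=1}=\mathbf U^{K_T,k}|_{\tau=1},\qquad k=1,\dots,K_S,$$ and, at all interior temporal interfaces, $$[\![\mathbf W^{n,k}]\!]^T\mathbf U^{n,k,*}=[\![\Phi^{n,k}]\!]\quad\text{at }\tau=-1,\qquad n=2,\dots,K_T,\ k=1,\dots,K_S,$$ and that the spatial numerical surface fluxes are $\tilde{\mathbf F}^{*}_{\hat n}=\hat s\left(n_1\mathbf F^{EC}_1+n_2\mathbf F^{EC}_2+n_3\mathbf F^{EC}_3\right)$, where the entropy conservative two-point fluxes $\mathbf F_m^{EC}$ are evaluated at the two states on either side of the spatial interface. Then the space-time DGSEM is entropy preserving in the sense that $$0=\bar S(\mathbf U(T))-\bar S(\mathbf u(0))+\sum_{k=1}^{K_S}\Big\langle[\![\Phi^{1,k}]\!]-[\![\mathbf W^{1,k}]\!]^T\mathbf u^{1,k},J^k\Big\rangle_N\Big|_{\tau=-1},$$ where $$\bar S(\mathbf U(T))=\sum_{k=1}^{K_S}\big\langle s(\mathbf U^{K_T,k}),J^k\big\rangle_N\big|_{\tau=1},\qquad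 \bar S(\mathbf u(0))=\sum_{k=1}^{K_S}\big\langle s(\mathbf u^{1,k}),J^k\big\rangle_N\big|_{\tau=-1}.$$
   Context: **Conservation law and entropy.** $\partial_t\mathbf u+\sum_{i=1}^3\partial_{x_i}\mathbf f_i(\mathbf u)=0$ is a system of $p$ conservation laws with a strongly convex entropy $s(\mathbf u)$, entropy variables $\mathbf w=\partial s/\partial\mathbf u$, and entropy fluxes $f^s_i$ satisfying $\mathbf w^T\,\partial\mathbf f_i/\partial\mathbf u=(\partial f_i^s/\partial\mathbf u)^T$. Put $\Phi=\mathbf w^T\mathbf u-s$ and $\Psi_i=\mathbf w^T\mathbf f_i-f_i^s$. All states lie in the admissible set, where these functions are defined. **Mesh.** $[0,T]$ is divided into intervals $I_n$ of length $\Delta t^n$, $n=1,\dots,K_T$, each mapped affinely to $\tau\in[-1,1]$. The spatial domain is divided into $K_S$ conforming (possibly curved) hexahedral elements $e_k$, each the image of $E^3=[-1,1]^3$ (coordinates $\xi^1,\xi^2,\xi^3$) under a mapping $\vec\chi=(X_1,X_2,X_3)$. $J$ denotes the nodal values of the polynomial approximation of the Jacobian determinant (positive, time independent). The discrete contravariant vectors $J\vec a^{\,l}=(Ja^l_1,Ja^l_2,Ja^l_3)$, $l=1,2,3$, are $Ja^l_\alpha=-\big[\nabla_\xi\times \mathbb I^N(X_\gamma\nabla_\xi X_\beta)\big]_l$ ($l$-th component of the curl, $(\alpha,\beta,\gamma)$ cyclic, $\mathbb I^N$ the interpolation operator below), and hence satisfy the discrete metric identities $\sum_{l=1}^3\partial_{\xi^l}\mathbb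 I^N(Ja^l_m)=0$, $m=1,2,3$. On a face of $E^3$ with outward reference unit normal $\hat n=(\hat n^1,\hat n^2,\hat n^3)$, the scaled physical normal is $\hat s\vec n=\sum_l \hat n^l J\vec a^{\,l}$, with $\hat s=|\sum_l\hat n^lJ\vec a^{\,l}|$. At each interface the face nodes of the two adjacent elements coincide and $\hat s\vec n$ agrees up to sign. With periodic boundary conditions opposite boundary faces are identified, so that every face is an interface. **Nodes and operators.** Interpolation and quadrature use the Legendre-Gauss-Lobatto (LGL) nodes on $[-1,1]$: $M+1$ nodes $\tau_\sigma$ in time and $N+1$ nodes in each spatial direction, with LGL weights $\omega$ of the respective rule. $\mathcal D_{ij}=\ell_j'(\xi_i)$ is the derivative matrix of the Lagrange basis $\{\ell_j\}$ at the LGL nodes (of degree $M$ in time, $N$ in space). A function with nodal values $\mathbf U_{\sigma ijk}$ ($\sigma=0,\dots,M$; $i,j,k=0,\dots,N$) is a polynomial of degree $M$ in $\tau$ and of tensor degree $N$ in space; $\mathbb I^N$ is spatial tensor LGL interpolation. $\mathbf W$ has nodal values $\mathbf W_{\sigma ijk}=\mathbf w(\mathbf U_{\sigma ijk})$. Write $\omega_{ijk}=\omega_i\omega_j\omega_k$ and $\langle\mathbf F,\mathbf G\rangle_{N\times M}=\sum_{\sigma,i,j,k}\omega_\sigma\omega_{ijk}\mathbf F_{\sigma ijk}^T\mathbf G_{\sigma ijk}$. Write $\langle\mathbf F,\mathbf G\rangle_N|_{\tau=1}=\sum_{ijk}\omega_{ijk}\mathbf F_{Mijk}^T\mathbf G_{Mijk}$,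 $\langle\mathbf F,\mathbf G\rangle_N|_{\tau=-1}=\sum_{ijk}\omega_{ijk}\mathbf F_{0ijk}^T\mathbf G_{0ijk}$, and $\langle\cdot,\cdot\rangle_N|_{-1}^{1}$ for their difference (quantities without time index, such as $J^k$ or $\mathbf u^{1,k}$, enter through their spatial nodal values). $\int_{\partial E^3,N}\langle g,1\rangle_M\,dS$ is the sum over the six faces of $E^3$, the face LGL nodes and the time nodes $\sigma$ of $g$ times the product of the two face weights and $\omega_\sigma$. **Two-point functions.** $\mathbf U^\#(\cdot,\cdot)$ is consistent ($\mathbf U^\#(\mathbf a,\mathbf a)=\mathbf a$), symmetric, and satisfies $(\mathbf w(\mathbf a)-\mathbf w(\mathbf b))^T\mathbf U^\#(\mathbf a,\mathbf b)=\Phi(\mathbf a)-\Phi(\mathbf b)$. The $\mathbf F^{EC}_m(\cdot,\cdot)$, $m=1,2,3$, are consistent ($\mathbf F^{EC}_m(\mathbf a,\mathbf a)=\mathbf f_m(\mathbf a)$), symmetric, and satisfy $(\mathbf w(\mathbf a)-\mathbf w(\mathbf b))^T\mathbf F_m^{EC}(\mathbf a,\mathbf b)=\Psi_m(\mathbf a)-\Psi_m(\mathbf b)$. **Derivative projection operators.** $$(\mathbb D^M\mathbf U)_{\sigma ijk}=2\sum_{\theta=0}^M\mathcal D_{\sigma\theta}\mathbf U^\#(\mathbf U_{\sigma ijk},\mathbf U_{\theta ijk}),$$ $$(\mathbb D^N\!\cdot\tilde{\mathbf F}^{EC})_{\sigma ijk}=2\sum_{m=0}^N\sum_{r=1}^3\Big[\mathcal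 D_{im}\mathbf F_r^{EC}(\mathbf U_{\sigma ijk},\mathbf U_{\sigma mjk})\{\!\{Ja^1_r\}\!\}_{(i,m)jk}+\mathcal D_{jm}\mathbf F_r^{EC}(\mathbf U_{\sigma ijk},\mathbf U_{\sigma imk})\{\!\{Ja^2_r\}\!\}_{i(j,m)k}+\mathcal D_{km}\mathbf F_r^{EC}(\mathbf U_{\sigma ijk},\mathbf U_{\sigma ijm})\{\!\{Ja^3_r\}\!\}_{ij(k,m)}\Big],$$ where e.g. $\{\!\{\cdot\}\!\}_{(i,m)jk}=\frac12[(\cdot)_{ijk}+(\cdot)_{mjk}]$. **Scheme.** A space-time DGSEM solution is a family $\mathbf U^{n,k}$ of such polynomials with, for every $(n,k)$ and every vector-valued polynomial test function $\boldsymbol\varphi$ (degree $M$ in time, tensor degree $N$ in space), $A_T(\mathbf U,\boldsymbol\varphi)+A_S(\mathbf F,\boldsymbol\varphi)=0$, where (superscripts $n,k$ suppressed) $$A_T(\mathbf U,\boldsymbol\varphi)=\langle J\,\mathbb D^M\mathbf U,\boldsymbol\varphi\rangle_{N\times M}+\langle J(\mathbf U^*-\mathbf U),\boldsymbol\varphi\rangle_N\big|_{-1}^{1},$$ $$A_S(\mathbf F,\boldsymbol\varphi)=\frac{\Delta t}{2}\langle\mathbb D^N\!\cdot\tilde{\mathbf F}^{EC},\boldsymbol\varphi\rangle_{N\times M}+\frac{\Delta t}{2}\int_{\partial E^3,N}\langle\boldsymbol\varphi^T(\tilde{\mathbf F}^*_{\hat n}-\tilde{\mathbf F}_{\hat n}),1\rangle_M\,dS,$$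 with $\tilde{\mathbf F}_{\hat n}=\hat s\sum_m n_m\mathbf f_m(\mathbf U)$ and $\vec n$ pointing out of the element. **Jumps.** $[\![\cdot]\!]=(\cdot)_+-(\cdot)_-$. At the temporal interface $\tau=-1$ of element $(n,k)$, $+$ denotes the value in element $(n,k)$ at $\tau=-1$ and $-$ the value in element $(n-1,k)$ at $\tau=1$ (for $n=1$: the initial data $\mathbf u^{1,k}$). $\Phi^{n,k}$ and $\mathbf W^{n,k}$ denote $\Phi$ and $\mathbf w$ evaluated at these states. *)

theory Defs
  imports "HOL-Analysis.Analysis" "HOL-Computational_Algebra.Polynomial"
begin

section \<open>Legendre-Gauss-Lobatto nodes, weights and derivative matrix\<close>

text \<open>Rodrigues' formula.\<close>

definition legendre :: "nat \<Rightarrow> real poly" where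
  "legendre n = smult (1 / (2 ^ n * fact n)) ((pderiv ^^ n) ([:-1, 0, 1:] ^ n))"

text \<open>The \<open>n + 1\<close> LGL nodes (\<open>n \<ge> 1\<close>), in increasing order, are the zeros of
  \<open>(1 - x\<^sup>2) P\<^sub>n'(x)\<close>; the LGL weights are those of the interpolatory quadrature
  at these nodes.\<close>

definition lgl_node :: "nat \<Rightarrow> nat \<Rightarrow> real" where
  "lgl_node n i = sorted_list_of_set {x. poly ([:1, 0, -1:] * pderiv (legendre n)) x = 0} ! i"

definition lagrange :: "nat \<Rightarrow> nat \<Rightarrow> real poly" where
  "lagrange n j = (\<Prod>m\<in>{..n} - {j}. smult (1 / (lgl_node n j - lgl_node n m)) [:- lgl_node n m, 1:])"

definition lgl_weight :: "nat \<Rightarrow> nat \<Rightarrow> real" where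
  "lgl_weight n j = integral {-1..1} (poly (lagrange n j))"

definition deriv_matrix :: "nat \<Rightarrow> nat \<Rightarrow> nat \<Rightarrow> real" where
  "deriv_matrix n i j = poly (pderiv (lagrange n j)) (lgl_node n i)"

section \<open>Nodal values and discrete inner products\<close>

text \<open>Polynomials of tensor degree \<open>N\<close> in space (and degree \<open>M\<close> in time) are represented by
  their nodal values, functions of \<open>(i, j, k)\<close> (and of the time index \<open>\<sigma>\<close>);
  only the values at indices \<open>i, j, k \<le> N\<close> and \<open>\<sigma> \<le> M\<close> matter.\<close>

type_synonym node = "nat \<times> nat \<times> nat"

definition nodes :: "nat \<Rightarrow> node set" where
  "nodes N = {..N} \<times> {..N} \<times> {..N}"

definition node_point :: "nat \<Rightarrow> node \<Rightarrow> real^3" where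
  "node_point N = (\<lambda>(i, j, k). vector [lgl_node N i, lgl_node N j, lgl_node N k])"

definition node_weight :: "nat \<Rightarrow> node \<Rightarrow> real" where
  "node_weight N = (\<lambda>(i, j, k). lgl_weight N i * lgl_weight N j * lgl_weight N k)"

definition ip_space :: "nat \<Rightarrow> (node \<Rightarrow> 'v::real_inner) \<Rightarrow> (node \<Rightarrow> 'v) \<Rightarrow> real" where
  "ip_space N F G = (\<Sum>x\<in>nodes N. node_weight N x * (F x \<bullet> G x))"

definition ip_space_time ::
    "nat \<Rightarrow> nat \<Rightarrow> (nat \<Rightarrow> node \<Rightarrow> 'v::real_inner) \<Rightarrow> (nat \<Rightarrow> node \<Rightarrow> 'v) \<Rightarrow> real" where
  "ip_space_time N M F G =
     (\<Sum>\<sigma>\<le>M. \<Sum>x\<in>nodes N. lgl_weight M \<sigma> * node_weight N x * (F \<sigma> x \<bullet> G \<sigma> x))"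

definition interp :: "nat \<Rightarrow> (real^3 \<Rightarrow> 'v::real_vector) \<Rightarrow> real^3 \<Rightarrow> 'v" where
  "interp N g \<xi> = (\<Sum>(i, j, k)\<in>nodes N.
     (poly (lagrange N i) (\<xi>$1) * poly (lagrange N j) (\<xi>$2) * poly (lagrange N k) (\<xi>$3))
       *\<^sub>R g (node_point N (i, j, k)))"

section \<open>Reference element, Jacobian and discrete contravariant vectors\<close>

definition ref_cube :: "(real^3) set" where
  "ref_cube = {\<xi>. \<forall>l. \<xi>$l \<in> {-1..1}}"

text \<open>Partial derivative on the reference cube (one-sided on its boundary).\<close>

definition partial :: "3 \<Rightarrow> (real^3 \<Rightarrow> real) \<Rightarrow> real^3 \<Rightarrow> real" where
  "partial l g \<xi> =
     vector_derivative (\<lambda>t. g (\<chi> m. if m = l then t else \<xi>$m)) (at (\<xi>$l) within {-1..1})"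

definition ref_grad :: "(real^3 \<Rightarrow> real) \<Rightarrow> real^3 \<Rightarrow> real^3" where
  "ref_grad g \<xi> = (\<chi> l. partial l g \<xi>)"

text \<open>Addition in the index type \<open>3\<close> is modulo 3, so \<open>(l, l + 1, l + 2)\<close> is cyclic.\<close>

definition ref_curl :: "(real^3 \<Rightarrow> real^3) \<Rightarrow> real^3 \<Rightarrow> real^3" where
  "ref_curl F \<xi> =
     (\<chi> l. partial (l + 1) (\<lambda>\<eta>. F \<eta> $ (l + 2)) \<xi> - partial (l + 2) (\<lambda>\<eta>. F \<eta> $ (l + 1)) \<xi>)"

text \<open>Nodal values of the interpolant of the Jacobian determinant of the mapping \<open>X\<close>.\<close>

definition jac :: "nat \<Rightarrow> (real^3 \<Rightarrow> real^3) \<Rightarrow> node \<Rightarrow> real" where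
  "jac N X x = det (\<chi> m l. partial l (\<lambda>\<xi>. X \<xi> $ m) (node_point N x))"

text \<open>\<open>contravariant N X l x $ \<alpha>\<close> is \<open>Ja\<^sup>l\<^sub>\<alpha>\<close> at the node \<open>x\<close>,
  with \<open>(\<alpha>, \<beta>, \<gamma>) = (\<alpha>, \<alpha> + 1, \<alpha> + 2)\<close> cyclic.\<close>

definition contravariant :: "nat \<Rightarrow> (real^3 \<Rightarrow> real^3) \<Rightarrow> 3 \<Rightarrow> node \<Rightarrow> real^3" where
  "contravariant N X l x =
     (\<chi> \<alpha>. - ref_curl (interp N (\<lambda>\<xi>. (X \<xi> $ (\<alpha> + 2)) *\<^sub>R ref_grad (\<lambda>\<eta>. X \<eta> $ (\<alpha> + 1)) \<xi>))
               (node_point N x) $ l)"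

section \<open>Faces and periodic conforming meshes\<close>

text \<open>\<open>(l, True)\<close> is the face \<open>\<xi>\<^sup>l = 1\<close> and \<open>(l, False)\<close> the face \<open>\<xi>\<^sup>l = -1\<close>.\<close>

type_synonym face = "3 \<times> bool"

definition ref_face :: "face \<Rightarrow> (real^3) set" where
  "ref_face = (\<lambda>(l, s). {\<xi> \<in> ref_cube. \<xi>$l = (if s then 1 else -1)})"

definition ref_normal :: "face \<Rightarrow> real^3" where
  "ref_normal = (\<lambda>(l, s). axis l (if s then 1 else -1))"

definition face_node :: "nat \<Rightarrow> face \<Rightarrow> nat \<times> nat \<Rightarrow> node" where
  "face_node N = (\<lambda>(l, s) (a, b). let c = (if s then N else 0) in
     if l = 1 then (c, a, b) else if l = 2 then (a, c, b) else (a, b, c))"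

definition scaled_normal :: "nat \<Rightarrow> (real^3 \<Rightarrow> real^3) \<Rightarrow> face \<Rightarrow> nat \<times> nat \<Rightarrow> real^3" where
  "scaled_normal N X fc ab =
     (\<Sum>l\<in>UNIV. ref_normal fc $ l *\<^sub>R contravariant N X l (face_node N fc ab))"

definition shat :: "nat \<Rightarrow> (real^3 \<Rightarrow> real^3) \<Rightarrow> face \<Rightarrow> nat \<times> nat \<Rightarrow> real" where
  "shat N X fc ab = norm (scaled_normal N X fc ab)"

definition unit_normal :: "nat \<Rightarrow> (real^3 \<Rightarrow> real^3) \<Rightarrow> face \<Rightarrow> nat \<times> nat \<Rightarrow> real^3" where
  "unit_normal N X fc ab = (1 / shat N X fc ab) *\<^sub>R scaled_normal N X fc ab"

text \<open>Two quadrilateral faces can be attached to each other in eight ways, the symmetries of the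
  square: an optional exchange of the two face coordinates, followed by optional reflections.\<close>

type_synonym orientation = "bool \<times> bool \<times> bool"

definition match_node :: "nat \<Rightarrow> orientation \<Rightarrow> nat \<times> nat \<Rightarrow> nat \<times> nat" where
  "match_node N = (\<lambda>(swap, fa, fb) (a, b). let (a', b') = (if swap then (b, a) else (a, b)) in
     (if fa then N - a' else a', if fb then N - b' else b'))"

text \<open>Elements are numbered \<open>1, \<dots>, KS\<close>; element \<open>e\<close> is the image of the reference cube under
  \<open>X e\<close>, and \<open>\<Omega>\<close> is the spatial domain. \<open>glue (e, fc)\<close> is the element and face on the other side
  of the face \<open>fc\<close> of element \<open>e\<close>, \<open>orient (e, fc)\<close> describes which of its nodes corresponds to a
  given node, and \<open>shift (e, fc)\<close> is the translation under the periodic identification: it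
  vanishes at interfaces in the interior of \<open>\<Omega>\<close>, and is nonzero only for boundary faces.\<close>

locale periodic_mesh =
  fixes N KS :: nat
    and \<Omega> :: "(real^3) set"
    and X :: "nat \<Rightarrow> real^3 \<Rightarrow> real^3"
    and glue :: "nat \<times> face \<Rightarrow> nat \<times> face"
    and orient :: "nat \<times> face \<Rightarrow> orientation"
    and shift :: "nat \<times> face \<Rightarrow> real^3"
  assumes KS_pos: "KS \<ge> 1"
    and mapping_differentiable: "e \<in> {1..KS} \<Longrightarrow> X e differentiable_on ref_cube"
    and mapping_inj: "e \<in> {1..KS} \<Longrightarrow> inj_on (X e) ref_cube"
    and cover: "\<Omega> = (\<Union>e\<in>{1..KS}. X e ` ref_cube)"
    and non_overlapping: "\<lbrakk>e \<in> {1..KS}; e' \<in> {1..KS}; e \<noteq> e'\<rbrakk> \<Longrightarrow>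
          interior (X e ` ref_cube) \<inter> interior (X e' ` ref_cube) = {}"
    and jac_pos: "\<lbrakk>e \<in> {1..KS}; x \<in> nodes N\<rbrakk> \<Longrightarrow> jac N (X e) x > 0"
    and glue_range: "e \<in> {1..KS} \<Longrightarrow> fst (glue (e, fc)) \<in> {1..KS}"
    and glue_neq: "e \<in> {1..KS} \<Longrightarrow> glue (e, fc) \<noteq> (e, fc)"
    and glue_invol: "e \<in> {1..KS} \<Longrightarrow> glue (glue (e, fc)) = (e, fc)"
    and orient_invol: "\<lbrakk>e \<in> {1..KS}; ab \<in> {..N} \<times> {..N}\<rbrakk> \<Longrightarrow>
          match_node N (orient (glue (e, fc))) (match_node N (orient (e, fc)) ab) = ab"
    and shift_boundary: "\<lbrakk>e \<in> {1..KS}; shift (e, fc) \<noteq> 0\<rbrakk> \<Longrightarrow> X e ` ref_face fc \<subseteq> frontier \<Omega>"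
    and faces_conform: "\<lbrakk>e \<in> {1..KS}; glue (e, fc) = (e', fc')\<rbrakk> \<Longrightarrow>
          X e' ` ref_face fc' = (\<lambda>y. y + shift (e, fc)) ` X e ` ref_face fc"
    and face_nodes_coincide:
        "\<lbrakk>e \<in> {1..KS}; glue (e, fc) = (e', fc'); ab \<in> {..N} \<times> {..N}\<rbrakk> \<Longrightarrow>
          X e' (node_point N (face_node N fc' (match_node N (orient (e, fc)) ab))) =
          X e (node_point N (face_node N fc ab)) + shift (e, fc)"
    and normals_agree:
        "\<lbrakk>e \<in> {1..KS}; glue (e, fc) = (e', fc'); ab \<in> {..N} \<times> {..N}\<rbrakk> \<Longrightarrow>
          scaled_normal N (X e') fc' (match_node N (orient (e, fc)) ab) =
          - scaled_normal N (X e) fc ab"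

text \<open>Value, on the other side of an interface, of the field \<open>V\<close> (element \<open>\<times>\<close> node) at the node
  \<open>ab\<close> of the face \<open>fc\<close> of element \<open>e\<close>.\<close>

definition outer_value ::
    "nat \<Rightarrow> (nat \<times> face \<Rightarrow> nat \<times> face) \<Rightarrow> (nat \<times> face \<Rightarrow> orientation) \<Rightarrow>
     (nat \<Rightarrow> node \<Rightarrow> 'v) \<Rightarrow> nat \<Rightarrow> face \<Rightarrow> nat \<times> nat \<Rightarrow> 'v" where
  "outer_value N glue orient V e fc ab =
     (case glue (e, fc) of (e', fc') \<Rightarrow> V e' (face_node N fc' (match_node N (orient (e, fc)) ab)))"

section \<open>Conservation law, entropy and two-point functions\<close>

definition strongly_convex_on :: "'v::real_normed_vector set \<Rightarrow> ('v \<Rightarrow> real) \<Rightarrow> bool" where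
  "strongly_convex_on A s \<longleftrightarrow> (\<exists>\<mu>>0. convex_on A (\<lambda>u. s u - \<mu> / 2 * (norm u)\<^sup>2))"

text \<open>\<open>A\<close> is the admissible set, \<open>f i\<close> are the fluxes, \<open>w\<close> the entropy variables and \<open>fs i\<close> the
  entropy fluxes. The compatibility condition \<open>w\<^sup>T \<partial>f\<^sub>i/\<partial>u = (\<partial>f\<^sup>s\<^sub>i/\<partial>u)\<^sup>T\<close> is stated by applying
  both sides to an arbitrary vector \<open>h\<close>.\<close>

locale entropy_system =
  fixes A :: "(real^'p) set"
    and f :: "3 \<Rightarrow> real^'p \<Rightarrow> real^'p"
    and s :: "real^'p \<Rightarrow> real"
    and w :: "real^'p \<Rightarrow> real^'p"
    and fs :: "3 \<Rightarrow> real^'p \<Rightarrow> real"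
  assumes admissible_open: "open A"
    and admissible_convex: "convex A"
    and entropy_convex: "strongly_convex_on A s"
    and entropy_variables: "u \<in> A \<Longrightarrow> GDERIV s u :> w u"
    and flux_differentiable: "u \<in> A \<Longrightarrow> f i differentiable (at u)"
    and entropy_flux_differentiable: "u \<in> A \<Longrightarrow> fs i differentiable (at u)"
    and compatible: "u \<in> A \<Longrightarrow>
          w u \<bullet> frechet_derivative (f i) (at u) h = frechet_derivative (fs i) (at u) h"

definition entropy_potential ::
    "(real^'p \<Rightarrow> real^'p) \<Rightarrow> (real^'p \<Rightarrow> real) \<Rightarrow> real^'p \<Rightarrow> real" where
  "entropy_potential w s u = w u \<bullet> u - s u"

definition flux_potential ::
    "(real^'p \<Rightarrow> real^'p) \<Rightarrow> (3 \<Rightarrow> real^'p \<Rightarrow> real^'p) \<Rightarrow> (3 \<Rightarrow> real^'p \<Rightarrow> real) \<Rightarrow>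
     3 \<Rightarrow> real^'p \<Rightarrow> real" where
  "flux_potential w f fs i u = w u \<bullet> f i u - fs i u"

text \<open>\<open>G\<close> is a symmetric two-point function on \<open>A\<close>, consistent with \<open>g\<close>, which satisfies the
  discrete entropy condition for the potential \<open>\<Theta>\<close>.\<close>

definition entropy_conservative_two_point ::
    "(real^'p) set \<Rightarrow> (real^'p \<Rightarrow> real^'p) \<Rightarrow> (real^'p \<Rightarrow> real^'p) \<Rightarrow> (real^'p \<Rightarrow> real) \<Rightarrow>
     (real^'p \<Rightarrow> real^'p \<Rightarrow> real^'p) \<Rightarrow> bool" where
  "entropy_conservative_two_point A w g \<Theta> G \<longleftrightarrow>
     (\<forall>a\<in>A. G a a = g a) \<and>
     (\<forall>a\<in>A. \<forall>b\<in>A. G a b = G b a) \<and>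
     (\<forall>a\<in>A. \<forall>b\<in>A. (w a - w b) \<bullet> G a b = \<Theta> a - \<Theta> b)"

section \<open>The space-time DGSEM\<close>

definition time_derivative_proj ::
    "nat \<Rightarrow> (real^'p \<Rightarrow> real^'p \<Rightarrow> real^'p) \<Rightarrow> (nat \<Rightarrow> node \<Rightarrow> real^'p) \<Rightarrow>
     nat \<Rightarrow> node \<Rightarrow> real^'p" where
  "time_derivative_proj M Uh U \<sigma> x =
     2 *\<^sub>R (\<Sum>\<theta>\<le>M. deriv_matrix M \<sigma> \<theta> *\<^sub>R Uh (U \<sigma> x) (U \<theta> x))"

definition avg :: "(node \<Rightarrow> real) \<Rightarrow> node \<Rightarrow> node \<Rightarrow> real" where
  "avg g x y = (g x + g y) / 2"

definition space_divergence_proj ::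
    "nat \<Rightarrow> (real^3 \<Rightarrow> real^3) \<Rightarrow> (3 \<Rightarrow> real^'p \<Rightarrow> real^'p \<Rightarrow> real^'p) \<Rightarrow>
     (nat \<Rightarrow> node \<Rightarrow> real^'p) \<Rightarrow> nat \<Rightarrow> node \<Rightarrow> real^'p" where
  "space_divergence_proj N X FEC U \<sigma> = (\<lambda>(i, j, k).
     let Ja = (\<lambda>l r x. contravariant N X l x $ r) in
     2 *\<^sub>R (\<Sum>m\<le>N. \<Sum>r\<in>UNIV.
         (deriv_matrix N i m * avg (Ja 1 r) (i, j, k) (m, j, k))
            *\<^sub>R FEC r (U \<sigma> (i, j, k)) (U \<sigma> (m, j, k))
       + (deriv_matrix N j m * avg (Ja 2 r) (i, j, k) (i, m, k))
            *\<^sub>R FEC r (U \<sigma> (i, j, k)) (U \<sigma> (i, m, k))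
       + (deriv_matrix N k m * avg (Ja 3 r) (i, j, k) (i, j, m))
            *\<^sub>R FEC r (U \<sigma> (i, j, k)) (U \<sigma> (i, j, m))))"

text \<open>\<open>Ub\<close> and \<open>Ut\<close> are the numerical states \<open>U\<^sup>*\<close> at \<open>\<tau> = -1\<close> and \<open>\<tau> = 1\<close>.\<close>

definition A_T ::
    "nat \<Rightarrow> nat \<Rightarrow> (real^3 \<Rightarrow> real^3) \<Rightarrow> (real^'p \<Rightarrow> real^'p \<Rightarrow> real^'p) \<Rightarrow>
     (nat \<Rightarrow> node \<Rightarrow> real^'p) \<Rightarrow> (node \<Rightarrow> real^'p) \<Rightarrow> (node \<Rightarrow> real^'p) \<Rightarrow>
     (nat \<Rightarrow> node \<Rightarrow> real^'p) \<Rightarrow> real" where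
  "A_T N M X Uh U Ub Ut \<phi> =
     ip_space_time N M (\<lambda>\<sigma> x. jac N X x *\<^sub>R time_derivative_proj M Uh U \<sigma> x) \<phi>
     + (ip_space N (\<lambda>x. jac N X x *\<^sub>R (Ut x - U M x)) (\<phi> M)
        - ip_space N (\<lambda>x. jac N X x *\<^sub>R (Ub x - U 0 x)) (\<phi> 0))"

definition face_integral :: "nat \<Rightarrow> nat \<Rightarrow> (face \<Rightarrow> nat \<Rightarrow> nat \<times> nat \<Rightarrow> real) \<Rightarrow> real" where
  "face_integral N M g =
     (\<Sum>fc\<in>UNIV. \<Sum>a\<le>N. \<Sum>b\<le>N. \<Sum>\<sigma>\<le>M.
        lgl_weight N a * lgl_weight N b * lgl_weight M \<sigma> * g fc \<sigma> (a, b))"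

definition normal_flux ::
    "nat \<Rightarrow> (real^3 \<Rightarrow> real^3) \<Rightarrow> face \<Rightarrow> nat \<times> nat \<Rightarrow> (3 \<Rightarrow> real^'p) \<Rightarrow> real^'p" where
  "normal_flux N X fc ab F = shat N X fc ab *\<^sub>R (\<Sum>m\<in>UNIV. (unit_normal N X fc ab $ m) *\<^sub>R F m)"

text \<open>\<open>Fstar fc \<sigma> ab\<close> is the numerical surface flux at the node \<open>ab\<close> of the face \<open>fc\<close>.\<close>

definition A_S ::
    "nat \<Rightarrow> nat \<Rightarrow> real \<Rightarrow> (real^3 \<Rightarrow> real^3) \<Rightarrow> (3 \<Rightarrow> real^'p \<Rightarrow> real^'p) \<Rightarrow>
     (3 \<Rightarrow> real^'p \<Rightarrow> real^'p \<Rightarrow> real^'p) \<Rightarrow> (nat \<Rightarrow> node \<Rightarrow> real^'p) \<Rightarrow>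
     (face \<Rightarrow> nat \<Rightarrow> nat \<times> nat \<Rightarrow> real^'p) \<Rightarrow> (nat \<Rightarrow> node \<Rightarrow> real^'p) \<Rightarrow> real" where
  "A_S N M dt X f FEC U Fstar \<phi> =
     dt / 2 * ip_space_time N M (space_divergence_proj N X FEC U) \<phi>
     + dt / 2 * face_integral N M (\<lambda>fc \<sigma> ab.
         \<phi> \<sigma> (face_node N fc ab) \<bullet>
           (Fstar fc \<sigma> ab - normal_flux N X fc ab (\<lambda>m. f m (U \<sigma> (face_node N fc ab)))))"

text \<open>\<open>U n e\<close> is the approximation in the space-time element \<open>(n, e)\<close>. The temporal interfaces are
  numbered \<open>0, \<dots>, KT\<close>, and \<open>Ustar n e\<close> is the numerical state at the \<open>n\<close>-th one, which is
  \<open>\<tau> = 1\<close> in the \<open>n\<close>-th and \<open>\<tau> = -1\<close> in the \<open>(n + 1)\<close>-st time interval.\<close>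

definition space_time_dgsem ::
    "nat \<Rightarrow> nat \<Rightarrow> nat \<Rightarrow> nat \<Rightarrow> (nat \<Rightarrow> real) \<Rightarrow> (nat \<Rightarrow> real^3 \<Rightarrow> real^3) \<Rightarrow>
     (3 \<Rightarrow> real^'p \<Rightarrow> real^'p) \<Rightarrow> (real^'p \<Rightarrow> real^'p \<Rightarrow> real^'p) \<Rightarrow>
     (3 \<Rightarrow> real^'p \<Rightarrow> real^'p \<Rightarrow> real^'p) \<Rightarrow>
     (nat \<Rightarrow> nat \<Rightarrow> node \<Rightarrow> real^'p) \<Rightarrow>
     (nat \<Rightarrow> nat \<Rightarrow> face \<Rightarrow> nat \<Rightarrow> nat \<times> nat \<Rightarrow> real^'p) \<Rightarrow>
     (nat \<Rightarrow> nat \<Rightarrow> nat \<Rightarrow> node \<Rightarrow> real^'p) \<Rightarrow> bool" where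
  "space_time_dgsem N M KT KS dt X f Uh FEC Ustar Fstar U \<longleftrightarrow>
     (\<forall>n\<in>{1..KT}. \<forall>e\<in>{1..KS}. \<forall>\<phi>.
        A_T N M (X e) Uh (U n e) (Ustar (n - 1) e) (Ustar n e) \<phi>
        + A_S N M (dt n) (X e) f FEC (U n e) (Fstar n e) \<phi> = 0)"

text \<open>Jump of \<open>g\<close> (a function of the state) at \<open>\<tau> = -1\<close> of the space-time element \<open>(n, e)\<close>.\<close>

definition time_jump ::
    "nat \<Rightarrow> (nat \<Rightarrow> node \<Rightarrow> 'u) \<Rightarrow> (nat \<Rightarrow> nat \<Rightarrow> nat \<Rightarrow> node \<Rightarrow> 'u) \<Rightarrow>
     ('u \<Rightarrow> 'v::ab_group_add) \<Rightarrow> nat \<Rightarrow> nat \<Rightarrow> node \<Rightarrow> 'v" where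
  "time_jump M u0 U g n e x =
     g (U n e 0 x) - g (if n = 1 then u0 e x else U (n - 1) e M x)"

definition total_entropy ::
    "nat \<Rightarrow> nat \<Rightarrow> (nat \<Rightarrow> real^3 \<Rightarrow> real^3) \<Rightarrow> ('u \<Rightarrow> real) \<Rightarrow> (nat \<Rightarrow> node \<Rightarrow> 'u) \<Rightarrow> real" where
  "total_entropy N KS X s V = (\<Sum>e = 1..KS. ip_space N (\<lambda>x. s (V e x)) (jac N (X e)))"

end

theory Submission
  imports Defs
begin

text \<open>
  The proof tests the scheme with the entropy variables and shows that everything cancels except
  the entropies at the initial and the final time and the jump at the initial time.

  The engine is summation by parts. The \<open>n + 1\<close> Gauss-Lobatto points are the zeros of
  \<open>(1 - x\<^sup>2) P\<^sub>n'\<close>, which is orthogonal to all polynomials of degree at most \<open>n - 2\<close>. Hence the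
  quadrature is exact up to degree \<open>2 n - 1\<close> (\<open>lgl_quadrature\<close>), which covers the products
  \<open>\<ell>\<^sub>i \<ell>\<^sub>j'\<close>. So the matrix \<open>Q\<^sub>i\<^sub>j = \<omega>\<^sub>i \<D>\<^sub>i\<^sub>j\<close> satisfies \<open>Q + Q\<^sup>T = diag (-1, 0, \<dots>, 0, 1)\<close>
  (\<open>summation_by_parts\<close>), and its rows sum to 0.

  For a symmetric two-point function \<open>G\<close> with \<open>(v\<^sub>i - v\<^sub>j)\<^sup>T G\<^sub>i\<^sub>j = \<theta>\<^sub>i - \<theta>\<^sub>j\<close> this turns
  \<open>\<Sum> 2 Q\<^sub>i\<^sub>j v\<^sub>i\<^sup>T G\<^sub>i\<^sub>j\<close> into the boundary values of \<open>v\<^sup>T G - \<theta>\<close> (\<open>flux_differencing\<close>). In time, \<open>v\<^sup>T G - \<theta>\<close>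
  at the boundary is \<open>w\<^sup>T U - \<Phi> = s\<close>. In space, the averaged metric terms leave in addition the
  potential times the discrete divergence of the contravariant vectors, and this divergence is
  zero because the vectors are a discrete curl (\<open>metric_identities\<close>).

  So each element has only face terms. In space they cancel in pairs across the interfaces, periodic
  ones included (\<open>face_entropy_production_cancels\<close>): the normals are opposite, the quadrature weights
  agree even if the face coordinates are exchanged or reflected, and the two-point condition
  says that \<open>w\<^sup>T F - \<Psi>\<close> is the same from both sides. In time the condition on the interior states says
  that \<open>w\<^sup>T U\<^sup>* - \<Phi>\<close> is continuous across interfaces, so that the sum over the time slabs telescopes.
\<close>

section \<open>Zeros and integrals of polynomials\<close>

text \<open>Rolle's theorem between neighbouring zeros. The zeros of the derivative are located strictly
  between elements of \<open>S\<close> so that, when \<open>S\<close> contains the end points of an interval, the new zeros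
  lie in its interior.\<close>

lemma rolle_roots:
  fixes p :: "real poly"
  assumes "finite S" "\<And>x. x \<in> S \<Longrightarrow> poly p x = 0"
  shows "\<exists>R. finite R \<and> card R + 1 \<ge> card S \<and>
           (\<forall>x\<in>R. poly (pderiv p) x = 0 \<and> (\<exists>a\<in>S. \<exists>b\<in>S. a < x \<and> x < b))"
  using assms
proof (induction S rule: finite_linorder_max_induct)
  case empty
  then show ?case by (auto intro: exI[of _ "{}"])
next
  case (insert b S)
  show ?case
  proof (cases "S = {}")
    case True
    then show ?thesis by (auto intro!: exI[of _ "{}"])
  next
    case False
    obtain R where R: "finite R" "card R + 1 \<ge> card S"
      "\<And>x. x \<in> R \<Longrightarrow> poly (pderiv p) x = 0"
      "\<And>x. x \<in> R \<Longrightarrow> \<exists>a\<in>S. \<exists>b\<in>S. a < x \<and> x < b"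
      using insert.IH insert.prems by fastforce
    define a where "a = Max S"
    have a: "a \<in> S" "a < b" "\<And>x. x \<in> S \<Longrightarrow> x \<le> a"
      using False insert.hyps by (auto simp: a_def)
    obtain c where c: "a < c" "c < b" "poly p b - poly p a = (b - a) * poly (pderiv p) c"
      using poly_MVT[OF a(2)] by blast
    have c0: "poly (pderiv p) c = 0" using c a insert.prems by auto
    have "c \<notin> R" using R(4) a(3) c(1) by fastforce
    then have "card (insert c R) + 1 \<ge> card (insert b S)"
      using R(1,2) insert.hyps by (simp add: card_insert_if)
    moreover have "\<forall>x\<in>insert c R. poly (pderiv p) x = 0 \<and>
        (\<exists>a\<in>insert b S. \<exists>b\<in>insert b S. a < x \<and> x < b)"
      using R(3,4) c a c0 by (auto; blast)
    ultimately show ?thesis using R(1) by (meson finite_insert)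
  qed
qed

definition poly_integral :: "real poly \<Rightarrow> real" where
  "poly_integral p = integral {-1..1} (poly p)"

lemma poly_integrable: "poly p integrable_on {a..b::real}"
  by (intro integrable_continuous_interval continuous_intros)

lemma poly_integral_add: "poly_integral (p + q) = poly_integral p + poly_integral q"
  unfolding poly_integral_def poly_add by (intro integral_add poly_integrable)

lemma poly_integral_smult: "poly_integral (smult c p) = c * poly_integral p"
  unfolding poly_integral_def poly_smult by simp

lemma poly_integral_0: "poly_integral 0 = 0"
  using poly_integral_smult[of 0 0] by simp

lemma poly_integral_sum: "poly_integral (\<Sum>i\<in>I. p i) = (\<Sum>i\<in>I. poly_integral (p i))"
  by (induction I rule: infinite_finite_induct) (auto simp: poly_integral_add poly_integral_0)

lemma poly_integral_pderiv: "poly_integral (pderiv p) = poly p 1 - poly p (-1)"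
proof -
  have "(poly (pderiv p) has_integral (poly p 1 - poly p (-1))) {-1..1}"
    by (rule fundamental_theorem_of_calculus)
       (auto simp flip: has_real_derivative_iff_has_vector_derivative
             intro: DERIV_subset poly_DERIV)
  then show ?thesis by (simp add: poly_integral_def integral_unique)
qed

lemma poly_integral_reflect: "poly_integral (pcompose p [:0, -1:]) = poly_integral p"
proof -
  have "poly (pcompose p [:0, -1:]) = (\<lambda>x. poly p (- x))" by (auto simp: poly_pcompose)
  then show ?thesis
    using Henstock_Kurzweil_Integration.integral_reflect_real[where f = "poly p" and a = "-1" and b = 1]
    by (simp add: poly_integral_def)
qed

text \<open>Integrating by parts \<open>k\<close> times moves all derivatives from \<open>g\<close> to \<open>r\<close>, where they give 0; the
  boundary terms vanish because every lower derivative of \<open>g\<close> vanishes at \<open>\<plusminus>1\<close>. With Rodrigues'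
  formula this is the orthogonality of Legendre polynomials to polynomials of lower degree.\<close>

lemma orthogonal_iterated_pderiv:
  assumes "\<And>j. j < k \<Longrightarrow> poly ((pderiv ^^ j) g) 1 = 0 \<and> poly ((pderiv ^^ j) g) (-1) = 0"
    and "(pderiv ^^ k) r = 0"
  shows "poly_integral (r * (pderiv ^^ k) g) = 0"
  using assms
proof (induction k arbitrary: r)
  case 0
  then show ?case by (simp add: poly_integral_0)
next
  case (Suc k)
  have "r * (pderiv ^^ Suc k) g + pderiv r * (pderiv ^^ k) g = pderiv (r * (pderiv ^^ k) g)"
    by (simp add: pderiv_mult algebra_simps)
  then have "poly_integral (r * (pderiv ^^ Suc k) g) + poly_integral (pderiv r * (pderiv ^^ k) g) = 0"
    using Suc.prems(1)[of k] by (metis poly_integral_add poly_integral_pderiv poly_mult mult_zero_right diff_self lessI)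
  moreover have "poly_integral (pderiv r * (pderiv ^^ k) g) = 0"
    using Suc.prems by (intro Suc.IH) (auto simp: funpow_swap1)
  ultimately show ?case by simp
qed

section \<open>Legendre-Gauss-Lobatto nodes\<close>

abbreviation rodrigues :: "nat \<Rightarrow> nat \<Rightarrow> real poly" where
  "rodrigues n k \<equiv> (pderiv ^^ k) ([:-1, 0, 1:] ^ n)"

text \<open>Each derivative lowers the multiplicity of the zeros \<open>\<plusminus>1\<close> of \<open>(x\<^sup>2 - 1)\<^sup>n\<close> by at most one.\<close>

lemma dvd_rodrigues: "k \<le> n \<Longrightarrow> [:-1, 0, 1:] ^ (n - k) dvd rodrigues n k"
proof (induction k)
  case (Suc k)
  then obtain q where q: "rodrigues n k = [:-1, 0, 1:] ^ Suc (n - Suc k) * q"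
    by (metis Suc_diff_Suc Suc_le_lessD Suc_leD dvd_def)
  have "rodrigues n (Suc k) = pderiv ([:-1, 0, 1:] ^ Suc (n - Suc k) * q)"
    using q by simp
  also have "[:-1, 0, 1:] ^ (n - Suc k) dvd \<dots>"
    unfolding pderiv_mult pderiv_power_Suc
    by (intro dvd_add dvd_mult2[OF le_imp_power_dvd] dvd_mult[OF dvd_mult2[OF dvd_smult[OF dvd_refl]]]) simp
  finally show ?case .
qed auto

lemma rodrigues_endpoints:
  assumes "k < n"
  shows "poly (rodrigues n k) 1 = 0" "poly (rodrigues n k) (-1) = 0"
proof -
  have "[:-1, 0, 1:] dvd rodrigues n k"
    using dvd_rodrigues[of k n] assms by (metis dvd_power dvd_trans less_imp_le zero_less_diff)
  then obtain q where "rodrigues n k = [:-1, 0, 1:] * q" by (auto simp: dvd_def)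
  then show "poly (rodrigues n k) 1 = 0" "poly (rodrigues n k) (-1) = 0" by auto
qed

lemma degree_rodrigues: "degree (rodrigues n k) = 2 * n - k"
  by (induction k) (auto simp: degree_pderiv degree_power_eq)

text \<open>As long as \<open>k < n\<close>, the \<open>k\<close>-th derivative still vanishes at \<open>\<plusminus>1\<close>. So its \<open>k\<close> interior zeros
  together with \<open>\<plusminus>1\<close> are \<open>k + 2\<close> zeros, and Rolle's theorem gives \<open>k + 1\<close> interior zeros of the next
  derivative.\<close>

lemma rodrigues_interior_roots:
  "k \<le> n \<Longrightarrow> \<exists>R. finite R \<and> k \<le> card R \<and> (\<forall>x\<in>R. -1 < x \<and> x < 1 \<and> poly (rodrigues n k) x = 0)"
proof (induction k)
  case 0
  show ?case by (auto intro: exI[of _ "{}"])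
next
  case (Suc k)
  obtain R where R: "finite R" "k \<le> card R"
    "\<And>x. x \<in> R \<Longrightarrow> -1 < x \<and> x < 1 \<and> poly (rodrigues n k) x = 0"
    using Suc by auto
  define S where "S = insert (-1) (insert 1 R)"
  have "finite S" "card S = card R + 2" using R by (force simp: S_def card_insert_if)+
  have Szero: "\<And>x. x \<in> S \<Longrightarrow> poly (rodrigues n k) x = 0"
    using R(3) rodrigues_endpoints[of k n] Suc.prems by (auto simp: S_def)
  obtain Z where Z: "finite Z" "card Z + 1 \<ge> card S" "\<And>x. x \<in> Z \<Longrightarrow>
      poly (pderiv (rodrigues n k)) x = 0 \<and> (\<exists>a\<in>S. \<exists>b\<in>S. a < x \<and> x < b)"
    using rolle_roots[of S "rodrigues n k"] Szero \<open>finite S\<close> by blast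
  have "\<And>x. x \<in> S \<Longrightarrow> -1 \<le> x \<and> x \<le> 1" using R(3) by (force simp: S_def)
  then have "\<And>x. x \<in> Z \<Longrightarrow> -1 < x \<and> x < 1" using Z(3) by (meson le_less_trans less_le_trans)
  then show ?case
    using Z \<open>card S = card R + 2\<close> R(2) by (intro exI[of _ Z]) auto
qed

definition lobatto_poly :: "nat \<Rightarrow> real poly" where
  "lobatto_poly n = [:1, 0, -1:] * pderiv (legendre n)"

lemma legendre_eq_rodrigues: "legendre n = smult (1 / (2 ^ n * fact n)) (rodrigues n n)"
  by (simp add: legendre_def)

lemma degree_legendre: "degree (legendre n) = n"
  by (simp add: legendre_eq_rodrigues degree_rodrigues)

lemma degree_lobatto_poly:
  assumes "n \<ge> 1"
  shows "degree (lobatto_poly n) = n + 1"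
proof -
  have "pderiv (legendre n) \<noteq> 0" using assms degree_legendre[of n] by (auto simp: pderiv_eq_0_iff)
  then show ?thesis
    using assms by (simp add: lobatto_poly_def degree_mult_eq degree_pderiv degree_legendre del: mult_pCons_left)
qed

abbreviation lobatto_roots :: "nat \<Rightarrow> real set" where
  "lobatto_roots n \<equiv> {x. poly (lobatto_poly n) x = 0}"

text \<open>One more application of Rolle's theorem to the \<open>n\<close> zeros of \<open>P\<^sub>n\<close> gives \<open>n - 1\<close> zeros of \<open>P\<^sub>n'\<close> in
  the open interval. With \<open>\<plusminus>1\<close> these are \<open>n + 1\<close> zeros, as many as the degree permits.\<close>

lemma lobatto_roots:
  assumes "n \<ge> 1"
  shows "finite (lobatto_roots n)" "card (lobatto_roots n) = n + 1" "lobatto_roots n \<subseteq> {-1..1}"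
    "1 \<in> lobatto_roots n" "-1 \<in> lobatto_roots n"
proof -
  have nz: "lobatto_poly n \<noteq> 0" using degree_lobatto_poly[OF assms] by auto
  show fin: "finite (lobatto_roots n)" using nz by (rule poly_roots_finite)
  have le: "card (lobatto_roots n) \<le> n + 1"
    using card_poly_roots_bound[OF nz] degree_lobatto_poly[OF assms] by simp
  show one: "1 \<in> lobatto_roots n" "-1 \<in> lobatto_roots n" by (auto simp: lobatto_poly_def)
  obtain R where R: "finite R" "n \<le> card R"
    "\<And>x. x \<in> R \<Longrightarrow> -1 < x \<and> x < 1 \<and> poly (rodrigues n n) x = 0"
    using rodrigues_interior_roots[of n n] by auto
  obtain Z where Z: "finite Z" "card Z + 1 \<ge> card R" "\<And>x. x \<in> Z \<Longrightarrow>
      poly (pderiv (rodrigues n n)) x = 0 \<and> (\<exists>a\<in>R. \<exists>b\<in>R. a < x \<and> x < b)"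
    using rolle_roots[of R "rodrigues n n"] R by auto
  have in01: "\<And>x. x \<in> Z \<Longrightarrow> -1 < x \<and> x < 1" using Z(3) R(3) by (meson less_trans)
  define S where "S = insert (-1) (insert 1 Z)"
  have "card S = card Z + 2" using in01 Z(1) by (force simp: S_def card_insert_if)
  then have cS: "card S \<ge> n + 1" using Z(2) R(2) by simp
  have sub: "S \<subseteq> lobatto_roots n"
    using Z(3) one by (auto simp: S_def lobatto_poly_def legendre_eq_rodrigues pderiv_smult)
  then have eq: "lobatto_roots n = S" using card_seteq[OF fin sub] cS le by simp
  show "card (lobatto_roots n) = n + 1" using cS le unfolding eq by linarith
  show "lobatto_roots n \<subseteq> {-1..1}" unfolding eq S_def using in01 by force
qed

lemma lgl_node_nth: "lgl_node n i = sorted_list_of_set (lobatto_roots n) ! i"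
  by (simp add: lgl_node_def lobatto_poly_def)

lemma lgl_node_image: "n \<ge> 1 \<Longrightarrow> lgl_node n ` {..n} = lobatto_roots n"
proof -
  assume n: "n \<ge> 1"
  have "lobatto_roots n = set (sorted_list_of_set (lobatto_roots n))"
    using lobatto_roots(1)[OF n] by simp
  also have "\<dots> = lgl_node n ` {..n}"
    unfolding set_conv_nth lgl_node_nth[abs_def] using lobatto_roots(2)[OF n] by fastforce
  finally show ?thesis by simp
qed

lemma lgl_node_less: "\<lbrakk>n \<ge> 1; i < j; j \<le> n\<rbrakk> \<Longrightarrow> lgl_node n i < lgl_node n j"
  unfolding lgl_node_nth using lobatto_roots(2)[of n]
  by (intro sorted_wrt_nth_less[OF strict_sorted_list_of_set]) auto

lemma lgl_node_inj: "n \<ge> 1 \<Longrightarrow> inj_on (lgl_node n) {..n}"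
  by (metis atMost_iff inj_onI lgl_node_less less_irrefl nat_neq_iff)

lemma lgl_node_bounds: "\<lbrakk>n \<ge> 1; i \<le> n\<rbrakk> \<Longrightarrow> lgl_node n i \<in> {-1..1}"
  using lgl_node_image[of n] lobatto_roots(3)[of n] by blast

lemma lgl_node_endpoints:
  assumes "n \<ge> 1"
  shows "lgl_node n 0 = -1" "lgl_node n n = 1"
proof -
  obtain i where i: "i \<le> n" "lgl_node n i = -1"
    using lobatto_roots(5)[OF assms] lgl_node_image[OF assms] by (metis (no_types, lifting) atMost_iff imageE)
  obtain j where j: "j \<le> n" "lgl_node n j = 1"
    using lobatto_roots(4)[OF assms] lgl_node_image[OF assms] by (metis (no_types, lifting) atMost_iff imageE)
  have "i = 0" using i lgl_node_less[OF assms, of 0 i] lgl_node_bounds[OF assms, of 0] by (cases i) auto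
  then show "lgl_node n 0 = -1" using i by simp
  have "j = n" using j lgl_node_less[OF assms, of j n] lgl_node_bounds[OF assms, of n] by (cases "j = n") auto
  then show "lgl_node n n = 1" using j by simp
qed

lemma pcompose_neg_iterated_pderiv:
  fixes p :: "real poly"
  shows "pcompose ((pderiv ^^ k) p) [:0, -1:] = smult ((-1) ^ k) ((pderiv ^^ k) (pcompose p [:0, -1:]))"
proof (induction k)
  case (Suc k)
  have "pderiv (pcompose ((pderiv ^^ k) p) [:0, -1:]) = smult (-1) (pcompose ((pderiv ^^ Suc k) p) [:0, -1:])"
    by (simp add: pderiv_pcompose pderiv_pCons)
  then have "pcompose ((pderiv ^^ Suc k) p) [:0, -1:] = smult (-1) (pderiv (pcompose ((pderiv ^^ k) p) [:0, -1:]))"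
    by simp
  also have "\<dots> = smult ((-1) ^ Suc k) ((pderiv ^^ Suc k) (pcompose p [:0, -1:]))"
    unfolding Suc.IH by (simp add: pderiv_smult)
  finally show ?case .
qed auto

text \<open>\<open>(x\<^sup>2 - 1)\<^sup>n\<close> is even, so each of its derivatives is even or odd.\<close>

lemma lobatto_roots_uminus: "x \<in> lobatto_roots n \<Longrightarrow> -x \<in> lobatto_roots n"
proof -
  assume x: "x \<in> lobatto_roots n"
  have even: "pcompose ([:-1, 0, 1:] ^ n) [:0, -1:] = ([:-1, 0, 1:] ^ n :: real poly)"
    by (simp add: poly_eq_poly_eq_iff[symmetric] fun_eq_iff poly_pcompose)
  have P: "pderiv (legendre n) = smult (1 / (2 ^ n * fact n)) ((pderiv ^^ Suc n) ([:-1, 0, 1:] ^ n))"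
    by (simp add: legendre_def pderiv_smult)
  have "poly (pderiv (legendre n)) (-x) = poly (pcompose (pderiv (legendre n)) [:0, -1:]) x"
    by (simp add: poly_pcompose)
  also have "\<dots> = (-1) ^ Suc n * poly (pderiv (legendre n)) x"
    unfolding P pcompose_smult pcompose_neg_iterated_pderiv even by simp
  finally show ?thesis using x by (auto simp: lobatto_poly_def)
qed

text \<open>Negating and reversing the sorted list of nodes gives a sorted list of the same set, hence
  the same list.\<close>

lemma lgl_node_symmetric:
  assumes "n \<ge> 1" "i \<le> n"
  shows "lgl_node n (n - i) = - lgl_node n i"
proof -
  let ?L = "sorted_list_of_set (lobatto_roots n)"
  have L: "set ?L = lobatto_roots n" "length ?L = n + 1" "sorted ?L" "distinct ?L"
    using lobatto_roots(1,2)[OF assms(1)] by auto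
  have "uminus ` lobatto_roots n = lobatto_roots n"
    using lobatto_roots_uminus[of _ n] by (auto simp: image_iff) (metis minus_minus)
  then have "rev (map uminus ?L) = ?L"
    using L by (intro sorted_distinct_set_unique)
      (auto simp: sorted_wrt_rev sorted_wrt_map distinct_map)
  then have "?L ! i = rev (map uminus ?L) ! i" by simp
  also have "\<dots> = - ?L ! (n - i)" using assms L by (simp add: rev_nth)
  finally show ?thesis by (simp add: lgl_node_nth)
qed

section \<open>Gauss-Lobatto quadrature and summation by parts\<close>

lemma lagrange_node:
  assumes "n \<ge> 1" "i \<le> n" "j \<le> n"
  shows "poly (lagrange n j) (lgl_node n i) = (if i = j then 1 else 0)"
proof (cases "i = j")
  case True
  have "\<And>m. m \<in> {..n} - {j} \<Longrightarrow> lgl_node n j \<noteq> lgl_node n m"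
    using inj_onD[OF lgl_node_inj[OF assms(1)]] assms by fastforce
  then show ?thesis using True by (simp add: lagrange_def poly_prod divide_simps)
next
  case False
  then have "\<exists>m\<in>{..n} - {j}. lgl_node n i - lgl_node n m = 0" using assms by (intro bexI[of _ i]) auto
  then show ?thesis using False by (auto simp: lagrange_def poly_prod)
qed

lemma degree_lagrange:
  assumes "j \<le> n"
  shows "degree (lagrange n j) \<le> n"
proof -
  have "degree (lagrange n j) \<le>
      (\<Sum>m\<in>{..n} - {j}. degree (smult (1 / (lgl_node n j - lgl_node n m)) [:- lgl_node n m, 1:]))"
    using degree_prod_sum_le[of "{..n} - {j}" "\<lambda>m. smult (1 / (lgl_node n j - lgl_node n m)) [:- lgl_node n m, 1:]"]
    by (simp only: lagrange_def o_def finite_Diff finite_atMost simp_thms)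
  also have "\<dots> \<le> (\<Sum>m\<in>{..n} - {j}. 1)" by (intro sum_mono) auto
  finally show ?thesis using assms by simp
qed

lemma poly_eq_on_lgl_nodes:
  assumes "n \<ge> 1" "degree p \<le> n" "degree q \<le> n"
    and "\<And>i. i \<le> n \<Longrightarrow> poly p (lgl_node n i) = poly q (lgl_node n i)"
  shows "p = q"
proof (rule poly_eqI_degree)
  show "poly p x = poly q x" if "x \<in> lgl_node n ` {..n}" for x using assms(4) that by auto
  have "card (lgl_node n ` {..n}) = n + 1"
    using lgl_node_image[OF assms(1)] lobatto_roots(2)[OF assms(1)] by simp
  then show "card (lgl_node n ` {..n}) > degree p" "card (lgl_node n ` {..n}) > degree q"
    using assms by auto
qed

lemma lagrange_interpolation:
  assumes "n \<ge> 1" "degree p \<le> n"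
  shows "p = (\<Sum>i\<le>n. smult (poly p (lgl_node n i)) (lagrange n i))"
proof (rule poly_eq_on_lgl_nodes[OF assms])
  show "degree (\<Sum>i\<le>n. smult (poly p (lgl_node n i)) (lagrange n i)) \<le> n"
    by (intro degree_sum_le) (auto intro: order_trans[OF degree_smult_le] degree_lagrange)
  show "poly p (lgl_node n i) = poly (\<Sum>i\<le>n. smult (poly p (lgl_node n i)) (lagrange n i)) (lgl_node n i)"
    if "i \<le> n" for i
    using assms that by (simp add: poly_sum lagrange_node if_distrib[of "\<lambda>x. _ * x"] cong: if_cong)
qed

lemma lgl_weight_integral: "lgl_weight n j = poly_integral (lagrange n j)"
  by (simp add: lgl_weight_def poly_integral_def)

lemma iterated_pderiv_eq_0: "degree (p :: real poly) < k \<Longrightarrow> (pderiv ^^ k) p = 0"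
proof (induction k)
  case (Suc k)
  then have "degree ((pderiv ^^ k) p) = 0" by (simp add: degree_higher_pderiv)
  then show ?case by (simp add: pderiv_eq_0_iff)
qed simp

text \<open>Gauss quadrature rests on the orthogonality of the nodal polynomial to low degrees. Here one
  integration by parts turns \<open>\<integral> (1 - x\<^sup>2) P\<^sub>n' q\<close> into \<open>- \<integral> ((1 - x\<^sup>2) q)' P\<^sub>n\<close>, whose first factor has
  degree less than \<open>n\<close>.\<close>

lemma lobatto_poly_orthogonal:
  assumes "degree q + 2 \<le> n"
  shows "poly_integral (lobatto_poly n * q) = 0"
proof -
  define r where "r = [:1, 0, -1:] * q"
  have "degree r \<le> degree q + 2"
    unfolding r_def by (rule order_trans[OF degree_mult_le]) simp
  then have "degree (pderiv r) < n" using assms by (simp add: degree_pderiv)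
  then have "(pderiv ^^ n) (pderiv r) = 0" by (rule iterated_pderiv_eq_0)
  then have "poly_integral (pderiv r * rodrigues n n) = 0"
    using rodrigues_endpoints by (intro orthogonal_iterated_pderiv) auto
  moreover have "pderiv r * legendre n = smult (1 / (2 ^ n * fact n)) (pderiv r * rodrigues n n)"
    by (simp add: legendre_eq_rodrigues)
  ultimately have "poly_integral (pderiv r * legendre n) = 0" by (simp add: poly_integral_smult)
  moreover have "lobatto_poly n * q + pderiv r * legendre n = pderiv (r * legendre n)"
    unfolding r_def lobatto_poly_def by (subst pderiv_mult) (simp only: mult_ac)
  then have "poly_integral (lobatto_poly n * q) + poly_integral (pderiv r * legendre n) =
      poly (r * legendre n) 1 - poly (r * legendre n) (-1)"
    by (simp only: poly_integral_add[symmetric] poly_integral_pderiv)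
  moreover have "poly r 1 = 0" "poly r (-1) = 0" by (simp_all add: r_def)
  ultimately show ?thesis by simp
qed

text \<open>Divide \<open>p\<close> by the nodal polynomial: the multiple of the nodal polynomial contributes nothing to
  the integral (by orthogonality) nor to the sum (it vanishes at the nodes), and the remainder has
  degree at most \<open>n\<close>, where the rule is exact because it is interpolatory.\<close>

lemma lgl_quadrature:
  assumes "n \<ge> 1" "degree p + 1 \<le> 2 * n"
  shows "poly_integral p = (\<Sum>i\<le>n. lgl_weight n i * poly p (lgl_node n i))"
proof -
  define q r where "q = p div lobatto_poly n" and "r = p mod lobatto_poly n"
  have p: "p = lobatto_poly n * q + r" by (simp add: q_def r_def)
  have nz: "lobatto_poly n \<noteq> 0" using degree_lobatto_poly[OF assms(1)] by auto
  have r: "degree r \<le> n"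
    using degree_mod_less[OF nz, of p] degree_lobatto_poly[OF assms(1)] by (auto simp: r_def)
  have "poly_integral (lobatto_poly n * q) = 0"
  proof (cases "q = 0")
    case False
    have "degree (lobatto_poly n * q) \<le> max (degree p) (degree r)"
      using degree_diff_le_max[of p r] p by (metis add_diff_cancel_right')
    then have "n + 1 + degree q < 2 * n"
      using nz False assms r by (simp add: degree_mult_eq degree_lobatto_poly max_def split: if_splits)
    then show ?thesis by (intro lobatto_poly_orthogonal) simp
  qed (simp add: poly_integral_0)
  then have "poly_integral p = poly_integral r" by (simp add: p poly_integral_add)
  also have "\<dots> = poly_integral (\<Sum>i\<le>n. smult (poly r (lgl_node n i)) (lagrange n i))"
    using lagrange_interpolation[OF assms(1) r] by simp
  also have "\<dots> = (\<Sum>i\<le>n. lgl_weight n i * poly r (lgl_node n i))"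
    by (simp add: poly_integral_sum poly_integral_smult lgl_weight_integral mult.commute)
  also have "\<dots> = (\<Sum>i\<le>n. lgl_weight n i * poly p (lgl_node n i))"
  proof (intro sum.cong refl arg_cong2[where f = "(*)"])
    fix i assume "i \<in> {..n}"
    then have "poly (lobatto_poly n) (lgl_node n i) = 0" using lgl_node_image[OF assms(1)] by auto
    then show "poly r (lgl_node n i) = poly p (lgl_node n i)" by (simp add: p)
  qed
  finally show ?thesis .
qed

text \<open>The reflection of the interval permutes the nodes, hence the Lagrange polynomials. This matters
  where two faces are glued after a reflection of their coordinates.\<close>

lemma lgl_weight_symmetric:
  assumes "n \<ge> 1" "j \<le> n"
  shows "lgl_weight n (n - j) = lgl_weight n j"
proof -
  have "pcompose (lagrange n (n - j)) [:0, -1:] = lagrange n j"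
  proof (rule poly_eq_on_lgl_nodes[OF assms(1) _ degree_lagrange[OF assms(2)]])
    show "degree (pcompose (lagrange n (n - j)) [:0, -1:]) \<le> n"
      using degree_lagrange[of "n - j" n] by (simp add: degree_pcompose)
    fix i assume i: "i \<le> n"
    have "poly (pcompose (lagrange n (n - j)) [:0, -1:]) (lgl_node n i) =
        poly (lagrange n (n - j)) (lgl_node n (n - i))"
      using lgl_node_symmetric[OF assms(1) i] by (simp add: poly_pcompose)
    then show "poly (pcompose (lagrange n (n - j)) [:0, -1:]) (lgl_node n i) =
        poly (lagrange n j) (lgl_node n i)"
      using assms i by (auto simp: lagrange_node)
  qed
  then show ?thesis by (metis lgl_weight_integral poly_integral_reflect)
qed

text \<open>The products \<open>\<ell>\<^sub>i \<ell>\<^sub>j'\<close> have degree at most \<open>2 n - 1\<close>, for which the quadrature is exact. So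
  \<open>\<omega>\<^sub>i \<D>\<^sub>i\<^sub>j\<close> is the integral of \<open>\<ell>\<^sub>i \<ell>\<^sub>j'\<close>, and the identity is integration by parts for the Lagrange
  basis.\<close>

lemma summation_by_parts:
  assumes "n \<ge> 1" "i \<le> n" "j \<le> n"
  shows "lgl_weight n i * deriv_matrix n i j + lgl_weight n j * deriv_matrix n j i =
    (if i = n \<and> j = n then 1 else 0) - (if i = 0 \<and> j = 0 then 1 else 0)"
proof -
  have exact: "poly_integral (lagrange n a * pderiv (lagrange n b)) =
      lgl_weight n a * deriv_matrix n a b" if "a \<le> n" "b \<le> n" for a b
  proof -
    have "degree (lagrange n a * pderiv (lagrange n b)) \<le> n + (n - 1)"
      using degree_lagrange[OF that(1)] degree_lagrange[OF that(2)]
      by (intro order_trans[OF degree_mult_le] add_mono) (auto simp: degree_pderiv)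
    then have "poly_integral (lagrange n a * pderiv (lagrange n b)) =
        (\<Sum>k\<le>n. lgl_weight n k * poly (lagrange n a * pderiv (lagrange n b)) (lgl_node n k))"
      using assms by (intro lgl_quadrature) auto
    also have "\<dots> = (\<Sum>k\<le>n. if k = a then lgl_weight n a * deriv_matrix n a b else 0)"
      using assms that by (intro sum.cong) (auto simp: lagrange_node deriv_matrix_def)
    finally show ?thesis using that by simp
  qed
  have "lgl_weight n i * deriv_matrix n i j + lgl_weight n j * deriv_matrix n j i =
      poly_integral (pderiv (lagrange n i * lagrange n j))"
    using exact assms by (simp add: pderiv_mult poly_integral_add)
  also have "\<dots> = poly (lagrange n i) (lgl_node n n) * poly (lagrange n j) (lgl_node n n)
      - poly (lagrange n i) (lgl_node n 0) * poly (lagrange n j) (lgl_node n 0)"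
    using lgl_node_endpoints[OF assms(1)] by (simp add: poly_integral_pderiv)
  also have "\<dots> = (if i = n \<and> j = n then 1 else 0) - (if i = 0 \<and> j = 0 then 1 else 0)"
    using assms by (auto simp: lagrange_node)
  finally show ?thesis .
qed

lemma pderiv_sum_poly: "pderiv (\<Sum>i\<in>I. p i) = (\<Sum>i\<in>I. pderiv (p i))"
  using higher_pderiv_sum[of 1] by simp

lemma deriv_matrix_row_sum:
  assumes "n \<ge> 1"
  shows "(\<Sum>j\<le>n. deriv_matrix n i j) = 0"
proof -
  have "(\<Sum>j\<le>n. lagrange n j) = 1"
    using lagrange_interpolation[OF assms, of 1] by simp
  then have "pderiv (\<Sum>j\<le>n. lagrange n j) = 0" by simp
  moreover have "(\<Sum>j\<le>n. deriv_matrix n i j) = poly (pderiv (\<Sum>j\<le>n. lagrange n j)) (lgl_node n i)"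
    by (simp add: deriv_matrix_def poly_sum pderiv_sum_poly)
  ultimately show ?thesis by simp
qed

section \<open>Flux differencing along a grid line\<close>

text \<open>Only the symmetric part of \<open>\<omega>\<^sub>i \<D>\<^sub>i\<^sub>j\<close>, which lives on the boundary, sees a symmetric argument.\<close>

lemma sbp_skew_sum:
  fixes h :: "nat \<Rightarrow> nat \<Rightarrow> real"
  assumes "n \<ge> 1"
  shows "(\<Sum>i\<le>n. \<Sum>j\<le>n. lgl_weight n i * deriv_matrix n i j * (h i j + h j i)) = h n n - h 0 0"
proof -
  let ?Q = "\<lambda>i j. lgl_weight n i * deriv_matrix n i j"
  have "(\<Sum>i\<le>n. \<Sum>j\<le>n. ?Q i j * (h i j + h j i)) =
      (\<Sum>i\<le>n. \<Sum>j\<le>n. ?Q i j * h i j) + (\<Sum>i\<le>n. \<Sum>j\<le>n. ?Q i j * h j i)"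
    by (simp add: distrib_left sum.distrib)
  also have "(\<Sum>i\<le>n. \<Sum>j\<le>n. ?Q i j * h j i) = (\<Sum>i\<le>n. \<Sum>j\<le>n. ?Q j i * h i j)"
    by (rule sum.swap)
  also have "(\<Sum>i\<le>n. \<Sum>j\<le>n. ?Q i j * h i j) + (\<Sum>i\<le>n. \<Sum>j\<le>n. ?Q j i * h i j) =
      (\<Sum>i\<le>n. \<Sum>j\<le>n. (?Q i j + ?Q j i) * h i j)"
    by (simp add: distrib_right sum.distrib)
  also have "\<dots> = (\<Sum>i\<le>n. \<Sum>j\<le>n. (if j = n then if i = n then h n n else 0 else 0)
      - (if j = 0 then if i = 0 then h 0 0 else 0 else 0))"
    using summation_by_parts[OF assms] by (intro sum.cong refl) auto
  also have "\<dots> = h n n - h 0 0"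
    by (simp add: sum_subtractf)
  finally show ?thesis .
qed

text \<open>The entropy balance of flux differencing along one grid line. \<open>G\<close> stands for the nodal values of a
  two-point function, \<open>v\<close> for the entropy variables, \<open>\<theta>\<close> for the potential, and \<open>a\<close> for a metric
  coefficient (or the constant 1 in time). The two-point condition makes the volume terms a
  boundary term, up to the derivative of \<open>a\<close>; that defect is what the metric identities remove.\<close>

lemma flux_differencing:
  fixes v :: "nat \<Rightarrow> 'v::real_inner" and G :: "nat \<Rightarrow> nat \<Rightarrow> 'v" and a \<theta> :: "nat \<Rightarrow> real"
  assumes n: "n \<ge> 1"
    and sym: "\<And>i j. \<lbrakk>i \<le> n; j \<le> n\<rbrakk> \<Longrightarrow> G i j = G j i"
    and jump: "\<And>i j. \<lbrakk>i \<le> n; j \<le> n\<rbrakk> \<Longrightarrow> (v i - v j) \<bullet> G i j = \<theta> i - \<theta> j"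
  shows "(\<Sum>i\<le>n. \<Sum>j\<le>n. lgl_weight n i * deriv_matrix n i j * ((a i + a j) * (v i \<bullet> G i j))) =
      a n * (v n \<bullet> G n n - \<theta> n) - a 0 * (v 0 \<bullet> G 0 0 - \<theta> 0)
      + (\<Sum>i\<le>n. lgl_weight n i * \<theta> i * (\<Sum>j\<le>n. deriv_matrix n i j * a j))"
proof -
  let ?Q = "\<lambda>i j. lgl_weight n i * deriv_matrix n i j"
  \<comment> \<open>The summand is the symmetrization of \<open>h\<close> plus two terms that are easy to sum: one is the
     derivative of \<open>a\<close>, the other contains the derivative of a constant.\<close>
  let ?h = "\<lambda>i j. (a i + a j) / 2 * (v i \<bullet> G i j) - a i * \<theta> j / 2 - a i * \<theta> i / 2"
  have "(\<Sum>i\<le>n. \<Sum>j\<le>n. ?Q i j * ((a i + a j) * (v i \<bullet> G i j))) =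
      (\<Sum>i\<le>n. \<Sum>j\<le>n. ?Q i j * (?h i j + ?h j i) + ?Q i j * (\<theta> i * a j) + deriv_matrix n i j * (lgl_weight n i * a i * \<theta> i))"
  proof (intro sum.cong refl)
    fix i j assume ij: "i \<in> {..n}" "j \<in> {..n}"
    have e: "v i \<bullet> G i j = v j \<bullet> G j i + \<theta> i - \<theta> j"
      using jump[of i j] sym[of i j] ij by (simp add: inner_diff_left)
    show "?Q i j * ((a i + a j) * (v i \<bullet> G i j)) =
        ?Q i j * (?h i j + ?h j i) + ?Q i j * (\<theta> i * a j) + deriv_matrix n i j * (lgl_weight n i * a i * \<theta> i)"
      unfolding e by (simp add: field_simps)
  qed
  also have "\<dots> = ?h n n - ?h 0 0 + (\<Sum>i\<le>n. \<Sum>j\<le>n. ?Q i j * (\<theta> i * a j))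
      + (\<Sum>i\<le>n. (\<Sum>j\<le>n. deriv_matrix n i j) * (lgl_weight n i * a i * \<theta> i))"
    by (simp only: sum.distrib sbp_skew_sum[OF n, of ?h] sum_distrib_right)
  also have "(\<Sum>i\<le>n. \<Sum>j\<le>n. ?Q i j * (\<theta> i * a j)) =
      (\<Sum>i\<le>n. lgl_weight n i * \<theta> i * (\<Sum>j\<le>n. deriv_matrix n i j * a j))"
    by (simp add: sum_distrib_left mult_ac)
  finally show ?thesis using deriv_matrix_row_sum[OF n] by (simp add: field_simps)
qed

section \<open>Grid lines and discrete metric identities\<close>

text \<open>Grid lines in direction \<open>l\<close>: a node is given by its position on the line and by the position of the
  line in the transverse plane. This treats the three directions uniformly, and the end points of
  the lines are the nodes of the two faces orthogonal to direction \<open>l\<close>.\<close>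

definition line_node :: "3 \<Rightarrow> nat \<Rightarrow> nat \<times> nat \<Rightarrow> node" where
  "line_node l c = (\<lambda>(a, b). if l = 1 then (c, a, b) else if l = 2 then (a, c, b) else (a, b, c))"

definition coord :: "3 \<Rightarrow> node \<Rightarrow> nat" where
  "coord l = (\<lambda>(i, j, k). if l = 1 then i else if l = 2 then j else k)"

definition move :: "3 \<Rightarrow> nat \<Rightarrow> node \<Rightarrow> node" where
  "move l m = (\<lambda>(i, j, k). if l = 1 then (m, j, k) else if l = 2 then (i, m, k) else (i, j, m))"

lemma coord_line_node [simp]: "coord l (line_node l c ab) = c"
  by (auto simp: coord_def line_node_def split: prod.splits)

lemma move_line_node [simp]: "move l m (line_node l c ab) = line_node l m ab"
  by (auto simp: move_def line_node_def split: prod.splits)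

lemma line_node_in_nodes:
  "line_node l c ab \<in> nodes N \<longleftrightarrow> c \<le> N \<and> ab \<in> {..N} \<times> {..N}"
  by (cases ab) (auto simp: line_node_def nodes_def)

definition transverse :: "3 \<Rightarrow> node \<Rightarrow> nat \<times> nat" where
  "transverse l = (\<lambda>(i, j, k). if l = 1 then (j, k) else if l = 2 then (i, k) else (i, j))"

lemma transverse_line_node [simp]: "transverse l (line_node l c ab) = ab"
  by (cases ab) (auto simp: transverse_def line_node_def)

lemma line_node_transverse: "line_node l (coord l x) (transverse l x) = x"
  by (cases x) (auto simp: transverse_def coord_def line_node_def)

lemma coord_transverse_bounds:
  "x \<in> nodes N \<Longrightarrow> coord l x \<le> N \<and> transverse l x \<in> {..N} \<times> {..N}"
  by (metis line_node_in_nodes line_node_transverse)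

lemma line_node_cases:
  assumes "x \<in> nodes N"
  obtains c a b where "x = line_node l c (a, b)" "c \<le> N" "a \<le> N" "b \<le> N"
proof (cases "transverse l x")
  case (Pair a b)
  then have "x = line_node l (coord l x) (a, b)" using line_node_transverse[of l x] by simp
  then show ?thesis using assms line_node_in_nodes[of l "coord l x" "(a, b)" N] that by auto
qed

lemma face_node_line_node: "face_node N (l, s) ab = line_node l (if s then N else 0) ab"
  by (auto simp: face_node_def line_node_def split: prod.splits)

definition face_weight :: "nat \<Rightarrow> nat \<times> nat \<Rightarrow> real" where
  "face_weight N = (\<lambda>(a, b). lgl_weight N a * lgl_weight N b)"

lemma node_weight_line_node:
  "node_weight N (line_node l c ab) = lgl_weight N c * face_weight N ab"
  by (cases ab) (simp add: node_weight_def line_node_def face_weight_def)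

lemma sum_nodes_lines:
  "(\<Sum>x\<in>nodes N. g x) = (\<Sum>ab\<in>{..N} \<times> {..N}. \<Sum>c\<le>N. g (line_node l c ab))"
proof -
  have "(\<Sum>x\<in>nodes N. g x) = (\<Sum>(ab, c)\<in>({..N} \<times> {..N}) \<times> {..N}. g (line_node l c ab))"
    by (rule sum.reindex_bij_witness[where i = "\<lambda>(ab, c). line_node l c ab"
          and j = "\<lambda>x. (transverse l x, coord l x)"])
       (use coord_transverse_bounds in \<open>force simp: line_node_transverse line_node_in_nodes\<close>)+
  then show ?thesis by (simp add: sum.cartesian_product)
qed

definition line_deriv :: "nat \<Rightarrow> 3 \<Rightarrow> (node \<Rightarrow> real) \<Rightarrow> node \<Rightarrow> real" where
  "line_deriv N l g x = (\<Sum>m\<le>N. deriv_matrix N (coord l x) m * g (move l m x))"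

text \<open>Derivative matrices acting on different indices commute; this is the discrete counterpart of
  the symmetry of second derivatives.\<close>

lemma line_deriv_commute:
  assumes "l \<noteq> l'"
  shows "line_deriv N l (line_deriv N l' g) x = line_deriv N l' (line_deriv N l g) x"
proof -
  have c: "coord l (move l' m x) = coord l x" "coord l' (move l m x) = coord l' x"
    and mm: "move l' m' (move l m x) = move l m (move l' m' x)" for m m'
    using assms exhaust_3[of l] exhaust_3[of l'] by (auto simp: coord_def move_def split: prod.splits)
  show ?thesis
    unfolding line_deriv_def c mm sum_distrib_left by (subst sum.swap) (simp only: mult_ac)
qed

lemma partial_poly:
  assumes "\<xi> $ l \<in> {-1..1}"
    and "\<And>t. g (\<chi> m. if m = l then t else \<xi> $ m) = poly p t"
  shows "partial l g \<xi> = poly (pderiv p) (\<xi> $ l)"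
proof -
  have "((\<lambda>t. poly p t) has_vector_derivative poly (pderiv p) (\<xi> $ l)) (at (\<xi> $ l) within {-1..1})"
    by (rule has_vector_derivative_at_within)
       (simp flip: has_real_derivative_iff_has_vector_derivative)
  then show ?thesis
    unfolding partial_def assms(2) using assms(1)
    by (intro vector_derivative_within_closed_interval[of "-1" 1]) auto
qed

lemma node_point_nth: "node_point N x $ l = lgl_node N (coord l x)"
  using exhaust_3[of l] by (auto simp: node_point_def coord_def vector_3 split: prod.splits)

lemma coord_le: "x \<in> nodes N \<Longrightarrow> coord l x \<le> N"
  by (auto simp: coord_def nodes_def)

lemma move_in_nodes: "x \<in> nodes N \<Longrightarrow> m \<le> N \<Longrightarrow> move l m x \<in> nodes N"
  by (auto simp: move_def nodes_def)

text \<open>The tensor product basis, addressed by direction instead of by position in a triple.\<close>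

definition lagrange_product :: "nat \<Rightarrow> node \<Rightarrow> real^3 \<Rightarrow> real" where
  "lagrange_product N y \<xi> = poly (lagrange N (coord 1 y)) (\<xi> $ 1) *
     poly (lagrange N (coord 2 y)) (\<xi> $ 2) * poly (lagrange N (coord 3 y)) (\<xi> $ 3)"

lemma interp_lagrange_product:
  "interp N g \<xi> = (\<Sum>y\<in>nodes N. lagrange_product N y \<xi> *\<^sub>R g (node_point N y))"
  unfolding interp_def
  by (rule sum.cong) (simp_all add: lagrange_product_def coord_def split_beta)

lemma lagrange_product_line:
  assumes N: "N \<ge> 1" and "c \<le> N" "a \<le> N" "b \<le> N" "c' \<le> N" "a' \<le> N" "b' \<le> N"
  shows "lagrange_product N (line_node l c (a, b))
      (\<chi> m. if m = l then t else node_point N (line_node l c' (a', b')) $ m) =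
    (if (a, b) = (a', b') then poly (lagrange N c) t else 0)"
  using assms exhaust_3[of l]
  by (auto simp: lagrange_product_def node_point_nth coord_def line_node_def lagrange_node)

text \<open>Along a grid line the other two factors of each basis function are 0 or 1, so the restriction of an
  interpolant to the line is the one-dimensional interpolant of the values on that line. So
  differentiation at the nodes acts on the nodal values through the derivative matrix.\<close>

lemma partial_interp:
  assumes N: "N \<ge> 1" and x: "x \<in> nodes N"
  shows "partial l (\<lambda>\<eta>. interp N F \<eta> $ c) (node_point N x) =
    line_deriv N l (\<lambda>y. F (node_point N y) $ c) x"
proof -
  obtain c' a' b' where x': "x = line_node l c' (a', b')" "c' \<le> N" "a' \<le> N" "b' \<le> N"
    using x by (rule line_node_cases)
  define p where "p = (\<Sum>m\<le>N. smult (F (node_point N (move l m x)) $ c) (lagrange N m))"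
  have "interp N F (\<chi> m. if m = l then t else node_point N x $ m) $ c = poly p t" for t
  proof -
    have "interp N F (\<chi> m. if m = l then t else node_point N x $ m) $ c =
      (\<Sum>ab\<in>{..N} \<times> {..N}. \<Sum>m\<le>N. lagrange_product N (line_node l m ab)
        (\<chi> m. if m = l then t else node_point N x $ m) * F (node_point N (line_node l m ab)) $ c)"
      unfolding interp_lagrange_product by (simp add: sum_nodes_lines[of _ _ l])
    also have "\<dots> = (\<Sum>ab\<in>{..N} \<times> {..N}. if ab = (a', b') then
        \<Sum>m\<le>N. poly (lagrange N m) t * F (node_point N (line_node l m ab)) $ c else 0)"
    proof (intro sum.cong refl)
      fix ab assume "ab \<in> {..N} \<times> {..N}"
      then obtain a b where ab: "ab = (a, b)" "a \<le> N" "b \<le> N" by auto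
      show "(\<Sum>m\<le>N. lagrange_product N (line_node l m ab)
            (\<chi> m. if m = l then t else node_point N x $ m) * F (node_point N (line_node l m ab)) $ c) =
          (if ab = (a', b') then
            \<Sum>m\<le>N. poly (lagrange N m) t * F (node_point N (line_node l m ab)) $ c else 0)"
      proof (cases "ab = (a', b')")
        case True
        then show ?thesis unfolding x'(1) using x' ab N
          by (auto simp: lagrange_product_line intro!: sum.cong)
      next
        case False
        then show ?thesis unfolding x'(1) using x' ab N
          by (auto simp: lagrange_product_line intro!: sum.neutral)
      qed
    qed
    also have "\<dots> = poly p t"
      using x' by (simp add: p_def poly_sum mult.commute)
    finally show ?thesis .
  qed
  then have "partial l (\<lambda>\<eta>. interp N F \<eta> $ c) (node_point N x) = poly (pderiv p) (node_point N x $ l)"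
    using lgl_node_bounds[OF N coord_le[OF x]]
    by (intro partial_poly) (auto simp: node_point_nth)
  also have "\<dots> = line_deriv N l (\<lambda>y. F (node_point N y) $ c) x"
    by (simp add: p_def pderiv_sum_poly pderiv_smult poly_sum node_point_nth line_deriv_def deriv_matrix_def mult.commute)
  finally show ?thesis .
qed

text \<open>The contravariant vectors are nodal values of the curl of an interpolant. Its divergence, taken with
  derivative matrices, vanishes since these commute.\<close>

lemma metric_identities:
  assumes N: "N \<ge> 1" and x: "x \<in> nodes N"
  shows "(\<Sum>l\<in>UNIV. line_deriv N l (\<lambda>y. contravariant N X l y $ r) x) = 0"
proof -
  define g where "g c y = (X (node_point N y) $ (r + 2) *\<^sub>R
      ref_grad (\<lambda>\<eta>. X \<eta> $ (r + 1)) (node_point N y)) $ c" for c :: 3 and y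
  have Ja: "contravariant N X l y $ r =
      line_deriv N (l + 2) (g (l + 1)) y - line_deriv N (l + 1) (g (l + 2)) y"
    if "y \<in> nodes N" for l y
    by (simp add: contravariant_def ref_curl_def partial_interp[OF N that] g_def[abs_def] del: vector_scaleR_component)
  have "line_deriv N l (\<lambda>y. contravariant N X l y $ r) x =
      line_deriv N l (line_deriv N (l + 2) (g (l + 1))) x
      - line_deriv N l (line_deriv N (l + 1) (g (l + 2))) x" for l
    unfolding line_deriv_def[of N l] using x
    by (simp add: Ja move_in_nodes right_diff_distrib sum_subtractf)
  \<comment> \<open>For \<open>l = 2, 3\<close> the indices \<open>l + 1\<close> and \<open>l + 2\<close> reach 4 and 5, to be read modulo 3.\<close>
  moreover have wrap: "(4::3) = 1" "(5::3) = 2" by simp_all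
  ultimately show ?thesis
    by (simp add: sum_3 wrap line_deriv_commute[of 2 1] line_deriv_commute[of 3 1] line_deriv_commute[of 3 2])
qed

section \<open>Spatial entropy balance of an element\<close>

text \<open>If the scaled normal is zero, then so are both sides, and the division by its length does no
  harm.\<close>

lemma normal_flux_scaled_normal:
  "normal_flux N X fc ab F = (\<Sum>m\<in>UNIV. (scaled_normal N X fc ab $ m) *\<^sub>R F m)"
  by (auto simp: normal_flux_def unit_normal_def shat_def scaleR_sum_right intro!: sum.cong)

lemma scaled_normal_face:
  "scaled_normal N X (l, s) ab =
    (if s then 1 else -1) *\<^sub>R contravariant N X l (line_node l (if s then N else 0) ab)"
proof -
  have "scaled_normal N X (l, s) ab = (\<Sum>l'\<in>UNIV. if l' = l then
      (if s then 1 else -1) *\<^sub>R contravariant N X l (line_node l (if s then N else 0) ab) else 0)"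
    unfolding scaled_normal_def by (intro sum.cong refl) (auto simp: ref_normal_def face_node_line_node axis_def)
  then show ?thesis by simp
qed

lemma space_divergence_proj_lines:
  "space_divergence_proj N X FEC U \<sigma> x =
    (\<Sum>l\<in>UNIV. \<Sum>r\<in>UNIV. \<Sum>m\<le>N. (deriv_matrix N (coord l x) m *
      (contravariant N X l x $ r + contravariant N X l (move l m x) $ r))
        *\<^sub>R FEC r (U \<sigma> x) (U \<sigma> (move l m x)))"
proof -
  obtain i j k where x: "x = (i, j, k)" by (cases x)
  have "(\<Sum>l\<in>UNIV. \<Sum>r\<in>UNIV. \<Sum>m\<le>N. (deriv_matrix N (coord l x) m *
      (contravariant N X l x $ r + contravariant N X l (move l m x) $ r))
        *\<^sub>R FEC r (U \<sigma> x) (U \<sigma> (move l m x))) =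
    (\<Sum>m\<le>N. \<Sum>r\<in>UNIV. \<Sum>l\<in>UNIV. (deriv_matrix N (coord l x) m *
      (contravariant N X l x $ r + contravariant N X l (move l m x) $ r))
        *\<^sub>R FEC r (U \<sigma> x) (U \<sigma> (move l m x)))"
    by (subst sum.swap, subst (2) sum.swap, subst sum.swap) simp
  then show ?thesis
    by (simp add: x space_divergence_proj_def sum_3 Let_def avg_def coord_def move_def
        scaleR_sum_right scaleR_add_right)
qed

text \<open>Discrete Gauss theorem for the entropy: the volume terms tested with the entropy variables reduce
  to face terms. Flux differencing along every grid line leaves boundary terms and the sum of
  \<open>\<Psi>\<^sub>r\<close> times the discrete divergence of the contravariant vectors, which vanishes.\<close>

lemma space_divergence_entropy:
  fixes U :: "nat \<Rightarrow> node \<Rightarrow> real^'p"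
  assumes N: "N \<ge> 1"
    and FEC: "\<And>r. entropy_conservative_two_point A w (f r) (\<Psi> r) (FEC r)"
    and U: "\<And>x. x \<in> nodes N \<Longrightarrow> U \<sigma> x \<in> A"
  shows "(\<Sum>x\<in>nodes N. node_weight N x * (space_divergence_proj N X FEC U \<sigma> x \<bullet> w (U \<sigma> x))) =
    (\<Sum>fc\<in>UNIV. \<Sum>ab\<in>{..N} \<times> {..N}. face_weight N ab *
      (\<Sum>r\<in>UNIV. scaled_normal N X fc ab $ r *
        (w (U \<sigma> (face_node N fc ab)) \<bullet> f r (U \<sigma> (face_node N fc ab))
          - \<Psi> r (U \<sigma> (face_node N fc ab)))))"
proof -
  define Ja where "Ja l r x = contravariant N X l x $ r" for l r x
  define \<theta> where "\<theta> r x = \<Psi> r (U \<sigma> x)" for r x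
  define V where "V x = w (U \<sigma> x)" for x
  define E where "E r x = V x \<bullet> f r (U \<sigma> x) - \<theta> r x" for r x
  define B where "B l r ab = Ja l r (line_node l N ab) * E r (line_node l N ab)
      - Ja l r (line_node l 0 ab) * E r (line_node l 0 ab)" for l r ab
  have line: "(\<Sum>i\<le>N. \<Sum>m\<le>N. lgl_weight N i * deriv_matrix N i m *
      ((Ja l r (line_node l i ab) + Ja l r (line_node l m ab)) *
        (V (line_node l i ab) \<bullet> FEC r (U \<sigma> (line_node l i ab)) (U \<sigma> (line_node l m ab))))) =
      B l r ab + (\<Sum>i\<le>N. lgl_weight N i * \<theta> r (line_node l i ab) *
        line_deriv N l (Ja l r) (line_node l i ab))"
    if ab: "ab \<in> {..N} \<times> {..N}" for l r ab
  proof -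
    have inA: "U \<sigma> (line_node l i ab) \<in> A" if "i \<le> N" for i
      using ab that by (intro U) (simp add: line_node_in_nodes)
    have consistent: "FEC r a a = f r a" if "a \<in> A" for a
      using FEC[of r] that by (auto simp: entropy_conservative_two_point_def)
    have two_point: "FEC r a b = FEC r b a" "(w a - w b) \<bullet> FEC r a b = \<Psi> r a - \<Psi> r b"
      if "a \<in> A" "b \<in> A" for a b
      using FEC[of r] that by (auto simp: entropy_conservative_two_point_def)
    show ?thesis
      using flux_differencing[OF N, of "\<lambda>i m. FEC r (U \<sigma> (line_node l i ab)) (U \<sigma> (line_node l m ab))"
          "\<lambda>i. V (line_node l i ab)" "\<lambda>i. \<theta> r (line_node l i ab)" "\<lambda>i. Ja l r (line_node l i ab)"]
      by (simp add: inA consistent two_point V_def \<theta>_def B_def E_def line_deriv_def)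
  qed
  have dir: "(\<Sum>x\<in>nodes N. node_weight N x * (\<Sum>m\<le>N. deriv_matrix N (coord l x) m *
        ((Ja l r x + Ja l r (move l m x)) * (V x \<bullet> FEC r (U \<sigma> x) (U \<sigma> (move l m x)))))) =
      (\<Sum>ab\<in>{..N} \<times> {..N}. face_weight N ab * B l r ab)
      + (\<Sum>x\<in>nodes N. node_weight N x * \<theta> r x * line_deriv N l (Ja l r) x)" for l r
  proof -
    have "(\<Sum>x\<in>nodes N. node_weight N x * (\<Sum>m\<le>N. deriv_matrix N (coord l x) m *
          ((Ja l r x + Ja l r (move l m x)) * (V x \<bullet> FEC r (U \<sigma> x) (U \<sigma> (move l m x)))))) =
        (\<Sum>ab\<in>{..N} \<times> {..N}. face_weight N ab *
          (\<Sum>i\<le>N. \<Sum>m\<le>N. lgl_weight N i * deriv_matrix N i m *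
            ((Ja l r (line_node l i ab) + Ja l r (line_node l m ab)) *
              (V (line_node l i ab) \<bullet>
                FEC r (U \<sigma> (line_node l i ab)) (U \<sigma> (line_node l m ab))))))"
      unfolding sum_nodes_lines[of _ _ l]
      by (intro sum.cong refl) (auto simp: node_weight_line_node sum_distrib_left mult_ac)
    also have "\<dots> = (\<Sum>ab\<in>{..N} \<times> {..N}. face_weight N ab * B l r ab
        + (\<Sum>i\<le>N. node_weight N (line_node l i ab) * \<theta> r (line_node l i ab) *
            line_deriv N l (Ja l r) (line_node l i ab)))"
      by (intro sum.cong refl, subst line)
         (simp_all add: node_weight_line_node sum_distrib_left distrib_left mult_ac)
    also have "\<dots> = (\<Sum>ab\<in>{..N} \<times> {..N}. face_weight N ab * B l r ab)
        + (\<Sum>x\<in>nodes N. node_weight N x * \<theta> r x * line_deriv N l (Ja l r) x)"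
      unfolding sum_nodes_lines[of _ _ l] by (simp add: sum.distrib)
    finally show ?thesis .
  qed
  have "(\<Sum>x\<in>nodes N. node_weight N x * (space_divergence_proj N X FEC U \<sigma> x \<bullet> w (U \<sigma> x))) =
      (\<Sum>x\<in>nodes N. \<Sum>l\<in>UNIV. \<Sum>r\<in>UNIV. node_weight N x * (\<Sum>m\<le>N. deriv_matrix N (coord l x) m *
        ((Ja l r x + Ja l r (move l m x)) * (V x \<bullet> FEC r (U \<sigma> x) (U \<sigma> (move l m x))))))"
    by (simp add: space_divergence_proj_lines inner_sum_left inner_sum_right sum_distrib_left Ja_def V_def inner_commute mult_ac)
  also have "\<dots> = (\<Sum>l\<in>UNIV. \<Sum>r\<in>UNIV. \<Sum>x\<in>nodes N. node_weight N x * (\<Sum>m\<le>N. deriv_matrix N (coord l x) m *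
        ((Ja l r x + Ja l r (move l m x)) * (V x \<bullet> FEC r (U \<sigma> x) (U \<sigma> (move l m x))))))"
    by (subst sum.swap) (intro sum.cong refl sum.swap)
  also have "\<dots> = (\<Sum>l\<in>UNIV. \<Sum>r\<in>UNIV. \<Sum>ab\<in>{..N} \<times> {..N}. face_weight N ab * B l r ab)
      + (\<Sum>l\<in>UNIV. \<Sum>r\<in>UNIV. \<Sum>x\<in>nodes N. node_weight N x * \<theta> r x * line_deriv N l (Ja l r) x)"
    by (simp only: dir sum.distrib)
  also have "(\<Sum>l\<in>UNIV. \<Sum>r\<in>UNIV. \<Sum>x\<in>nodes N. node_weight N x * \<theta> r x * line_deriv N l (Ja l r) x) =
      (\<Sum>r\<in>UNIV. \<Sum>x\<in>nodes N. node_weight N x * \<theta> r x * (\<Sum>l\<in>UNIV. line_deriv N l (Ja l r) x))"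
    unfolding sum_distrib_left by (subst sum.swap) (intro sum.cong refl sum.swap)
  also have "\<dots> = 0"
    using metric_identities[OF N] by (intro sum.neutral ballI) (simp add: Ja_def[abs_def])
  also have "(\<Sum>l\<in>UNIV. \<Sum>r\<in>UNIV. \<Sum>ab\<in>{..N} \<times> {..N}. face_weight N ab * B l r ab) =
      (\<Sum>l\<in>UNIV. \<Sum>ab\<in>{..N} \<times> {..N}. face_weight N ab * (\<Sum>r\<in>UNIV. B l r ab))"
    unfolding sum_distrib_left by (intro sum.cong refl sum.swap)
  also have "\<dots> = (\<Sum>l\<in>UNIV. \<Sum>s\<in>UNIV. \<Sum>ab\<in>{..N} \<times> {..N}. face_weight N ab *
      (\<Sum>r\<in>UNIV. scaled_normal N X (l, s) ab $ r * E r (face_node N (l, s) ab)))"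
    by (simp add: UNIV_bool scaled_normal_face face_node_line_node B_def Ja_def sum_subtractf
        right_diff_distrib sum_negf)
  also have "\<dots> = (\<Sum>fc\<in>UNIV. \<Sum>ab\<in>{..N} \<times> {..N}. face_weight N ab *
      (\<Sum>r\<in>UNIV. scaled_normal N X fc ab $ r * E r (face_node N fc ab)))"
    by (subst sum.cartesian_product) (simp add: split_beta)
  finally show ?thesis by (simp add: E_def V_def \<theta>_def)
qed

section \<open>Temporal entropy balance of an element\<close>

text \<open>Flux differencing with the coefficient 1. If \<open>\<Phi>\<close> is the entropy potential, then \<open>w\<^sup>T u - \<Phi>\<close> is
  the entropy, and the temporal volume terms produce exactly its difference over the time slab.\<close>

lemma time_derivative_entropy:
  fixes U :: "nat \<Rightarrow> node \<Rightarrow> real^'p"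
  assumes M: "M \<ge> 1"
    and Uh: "entropy_conservative_two_point A w (\<lambda>a. a) \<Phi> Uh"
    and U: "\<And>\<sigma>. \<sigma> \<le> M \<Longrightarrow> U \<sigma> x \<in> A"
  shows "(\<Sum>\<sigma>\<le>M. lgl_weight M \<sigma> * (time_derivative_proj M Uh U \<sigma> x \<bullet> w (U \<sigma> x))) =
    (w (U M x) \<bullet> U M x - \<Phi> (U M x)) - (w (U 0 x) \<bullet> U 0 x - \<Phi> (U 0 x))"
proof -
  have consistent: "Uh a a = a" if "a \<in> A" for a
    using Uh that by (auto simp: entropy_conservative_two_point_def)
  have two_point: "Uh a b = Uh b a" "(w a - w b) \<bullet> Uh a b = \<Phi> a - \<Phi> b" if "a \<in> A" "b \<in> A" for a b
    using Uh that by (auto simp: entropy_conservative_two_point_def)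
  have "(\<Sum>\<sigma>\<le>M. lgl_weight M \<sigma> * (time_derivative_proj M Uh U \<sigma> x \<bullet> w (U \<sigma> x))) =
      (\<Sum>i\<le>M. \<Sum>j\<le>M. lgl_weight M i * deriv_matrix M i j *
        ((1 + 1) * (w (U i x) \<bullet> Uh (U i x) (U j x))))"
    by (simp add: time_derivative_proj_def inner_sum_left inner_sum_right sum_distrib_left
        inner_commute mult_ac)
  also have "\<dots> = (w (U M x) \<bullet> U M x - \<Phi> (U M x)) - (w (U 0 x) \<bullet> U 0 x - \<Phi> (U 0 x))"
    using flux_differencing[OF M, of "\<lambda>i j. Uh (U i x) (U j x)" "\<lambda>i. w (U i x)" "\<lambda>i. \<Phi> (U i x)" "\<lambda>_. 1"]
    by (simp add: U consistent two_point deriv_matrix_row_sum[OF M])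
  finally show ?thesis .
qed

text \<open>The numerical states replace the interior ones in the boundary terms \<open>w\<^sup>T U\<close>, but not in the
  potential. So each end of the time slab contributes \<open>w\<^sup>T U\<^sup>* - \<Phi>\<close> in place of
  \<open>w\<^sup>T U - \<Phi>\<close>.\<close>

lemma A_T_entropy:
  fixes U :: "nat \<Rightarrow> node \<Rightarrow> real^'p"
  assumes M: "M \<ge> 1"
    and Uh: "entropy_conservative_two_point A w (\<lambda>a. a) \<Phi> Uh"
    and U: "\<And>\<sigma> x. \<lbrakk>\<sigma> \<le> M; x \<in> nodes N\<rbrakk> \<Longrightarrow> U \<sigma> x \<in> A"
  shows "A_T N M X Uh U Ub Ut (\<lambda>\<sigma> x. w (U \<sigma> x)) =
    ip_space N (\<lambda>x. w (U M x) \<bullet> Ut x - \<Phi> (U M x)) (jac N X)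
    - ip_space N (\<lambda>x. w (U 0 x) \<bullet> Ub x - \<Phi> (U 0 x)) (jac N X)"
proof -
  have "ip_space_time N M (\<lambda>\<sigma> x. jac N X x *\<^sub>R time_derivative_proj M Uh U \<sigma> x) (\<lambda>\<sigma> x. w (U \<sigma> x)) =
      (\<Sum>x\<in>nodes N. node_weight N x * jac N X x *
        (\<Sum>\<sigma>\<le>M. lgl_weight M \<sigma> * (time_derivative_proj M Uh U \<sigma> x \<bullet> w (U \<sigma> x))))"
    unfolding ip_space_time_def by (subst sum.swap) (simp add: sum_distrib_left mult_ac)
  also have "\<dots> = (\<Sum>x\<in>nodes N. node_weight N x * jac N X x *
      ((w (U M x) \<bullet> U M x - \<Phi> (U M x)) - (w (U 0 x) \<bullet> U 0 x - \<Phi> (U 0 x))))"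
    using U by (intro sum.cong refl arg_cong2[where f = "(*)"] time_derivative_entropy[OF M Uh]) auto
  finally show ?thesis
    unfolding A_T_def ip_space_def
    by (simp flip: sum.distrib sum_subtractf)
       (intro sum.cong refl, simp add: inner_diff_left inner_diff_right inner_commute algebra_simps)
qed

section \<open>Surface terms and their cancellation\<close>

text \<open>Contribution of one face node to the spatial entropy balance, with interior state \<open>a\<close> and exterior
  state \<open>b\<close>.\<close>

definition face_entropy_production ::
    "nat \<Rightarrow> (real^3 \<Rightarrow> real^3) \<Rightarrow> (real^'p \<Rightarrow> real^'p) \<Rightarrow> (3 \<Rightarrow> real^'p \<Rightarrow> real) \<Rightarrow>
     (3 \<Rightarrow> real^'p \<Rightarrow> real^'p \<Rightarrow> real^'p) \<Rightarrow> face \<Rightarrow> nat \<times> nat \<Rightarrow> real^'p \<Rightarrow> real^'p \<Rightarrow> real" where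
  "face_entropy_production N X w \<Psi> FEC fc ab a b =
     face_weight N ab * (\<Sum>r\<in>UNIV. scaled_normal N X fc ab $ r * (w a \<bullet> FEC r a b - \<Psi> r a))"

text \<open>The interior fluxes left over by the volume terms are the ones that the surface terms subtract. What
  remains at a face node is the numerical flux tested with \<open>w\<close>, minus the flux potential.\<close>

lemma A_S_entropy:
  fixes U :: "nat \<Rightarrow> node \<Rightarrow> real^'p"
  assumes N: "N \<ge> 1"
    and FEC: "\<And>r. entropy_conservative_two_point A w (f r) (\<Psi> r) (FEC r)"
    and U: "\<And>\<sigma> x. \<lbrakk>\<sigma> \<le> M; x \<in> nodes N\<rbrakk> \<Longrightarrow> U \<sigma> x \<in> A"
    and Fstar: "\<And>fc \<sigma> ab. \<lbrakk>\<sigma> \<le> M; ab \<in> {..N} \<times> {..N}\<rbrakk> \<Longrightarrow>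
      Fstar fc \<sigma> ab = normal_flux N X fc ab (\<lambda>r. FEC r (U \<sigma> (face_node N fc ab)) (V fc \<sigma> ab))"
  shows "A_S N M dt X f FEC U Fstar (\<lambda>\<sigma> x. w (U \<sigma> x)) =
    dt / 2 * (\<Sum>\<sigma>\<le>M. lgl_weight M \<sigma> * (\<Sum>fc\<in>UNIV. \<Sum>ab\<in>{..N} \<times> {..N}.
      face_entropy_production N X w \<Psi> FEC fc ab (U \<sigma> (face_node N fc ab)) (V fc \<sigma> ab)))"
proof -
  let ?in = "\<lambda>fc \<sigma> ab. U \<sigma> (face_node N fc ab)"
  let ?sn = "\<lambda>fc ab r. scaled_normal N X fc ab $ r"
  have volume: "ip_space_time N M (space_divergence_proj N X FEC U) (\<lambda>\<sigma> x. w (U \<sigma> x)) =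
      (\<Sum>\<sigma>\<le>M. lgl_weight M \<sigma> * (\<Sum>fc\<in>UNIV. \<Sum>ab\<in>{..N} \<times> {..N}. face_weight N ab *
        (\<Sum>r\<in>UNIV. ?sn fc ab r * (w (?in fc \<sigma> ab) \<bullet> f r (?in fc \<sigma> ab) - \<Psi> r (?in fc \<sigma> ab)))))"
    using space_divergence_entropy[OF N FEC, of U] U
    by (simp add: ip_space_time_def sum_distrib_left[symmetric] mult.assoc)
  have "face_integral N M (\<lambda>fc \<sigma> ab. w (?in fc \<sigma> ab) \<bullet>
        (Fstar fc \<sigma> ab - normal_flux N X fc ab (\<lambda>r. f r (?in fc \<sigma> ab)))) =
      (\<Sum>fc\<in>UNIV. \<Sum>ab\<in>{..N} \<times> {..N}. \<Sum>\<sigma>\<le>M. lgl_weight M \<sigma> * (face_weight N ab * (w (?in fc \<sigma> ab) \<bullet>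
        (Fstar fc \<sigma> ab - normal_flux N X fc ab (\<lambda>r. f r (?in fc \<sigma> ab))))))"
    by (simp add: face_integral_def sum.cartesian_product' face_weight_def mult_ac)
  also have "\<dots> = (\<Sum>fc\<in>UNIV. \<Sum>ab\<in>{..N} \<times> {..N}. \<Sum>\<sigma>\<le>M. lgl_weight M \<sigma> * (face_weight N ab *
      (\<Sum>r\<in>UNIV. ?sn fc ab r * (w (?in fc \<sigma> ab) \<bullet> FEC r (?in fc \<sigma> ab) (V fc \<sigma> ab)
        - w (?in fc \<sigma> ab) \<bullet> f r (?in fc \<sigma> ab)))))"
    by (intro sum.cong refl)
       (simp add: Fstar normal_flux_scaled_normal inner_diff_right inner_sum_right
         right_diff_distrib sum_subtractf)
  also have "\<dots> = (\<Sum>\<sigma>\<le>M. \<Sum>fc\<in>UNIV. \<Sum>ab\<in>{..N} \<times> {..N}. lgl_weight M \<sigma> * (face_weight N ab *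
      (\<Sum>r\<in>UNIV. ?sn fc ab r * (w (?in fc \<sigma> ab) \<bullet> FEC r (?in fc \<sigma> ab) (V fc \<sigma> ab)
        - w (?in fc \<sigma> ab) \<bullet> f r (?in fc \<sigma> ab)))))"
    by (subst sum.swap[of _ "{..M}"]) (intro sum.cong refl sum.swap)
  finally have surface: "face_integral N M (\<lambda>fc \<sigma> ab. w (?in fc \<sigma> ab) \<bullet>
        (Fstar fc \<sigma> ab - normal_flux N X fc ab (\<lambda>r. f r (?in fc \<sigma> ab)))) =
      (\<Sum>\<sigma>\<le>M. lgl_weight M \<sigma> * (\<Sum>fc\<in>UNIV. \<Sum>ab\<in>{..N} \<times> {..N}. face_weight N ab *
      (\<Sum>r\<in>UNIV. ?sn fc ab r * (w (?in fc \<sigma> ab) \<bullet> FEC r (?in fc \<sigma> ab) (V fc \<sigma> ab)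
        - w (?in fc \<sigma> ab) \<bullet> f r (?in fc \<sigma> ab)))))"
    by (simp only: sum_distrib_left)
  show ?thesis
    unfolding A_S_def volume surface distrib_left[symmetric] sum.distrib[symmetric] face_entropy_production_def
    by simp
qed

context periodic_mesh
begin

lemma face_node_in_nodes: "ab \<in> {..N} \<times> {..N} \<Longrightarrow> face_node N fc ab \<in> nodes N"
  by (cases fc) (auto simp: face_node_line_node line_node_in_nodes)

lemma match_node_in_range: "ab \<in> {..N} \<times> {..N} \<Longrightarrow> match_node N ori ab \<in> {..N} \<times> {..N}"
  by (cases ori, cases ab) (auto simp: match_node_def)

lemma face_weight_match_node:
  assumes "N \<ge> 1" "ab \<in> {..N} \<times> {..N}"
  shows "face_weight N (match_node N ori ab) = face_weight N ab"
  using assms lgl_weight_symmetric[of N]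
  by (cases ori, cases ab) (auto simp: match_node_def face_weight_def)

text \<open>Passing to the other side of an interface is an involution on the face nodes of the mesh that has the
  periodic faces among its pairs. The normal changes sign, and \<open>w\<^sup>T F - \<Psi>\<close> has the same value on both
  sides by the two-point condition. So the sum equals its own negative.\<close>

lemma face_entropy_production_cancels:
  fixes V :: "nat \<Rightarrow> node \<Rightarrow> real^'p"
  assumes N: "N \<ge> 1"
    and FEC: "\<And>r. entropy_conservative_two_point A w (f r) (\<Psi> r) (FEC r)"
    and V: "\<And>e x. \<lbrakk>e \<in> {1..KS}; x \<in> nodes N\<rbrakk> \<Longrightarrow> V e x \<in> A"
  shows "(\<Sum>e = 1..KS. \<Sum>fc\<in>UNIV. \<Sum>ab\<in>{..N} \<times> {..N}. face_entropy_production N (X e) w \<Psi> FEC fc ab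
    (V e (face_node N fc ab)) (outer_value N glue orient V e fc ab)) = 0"
proof -
  define g where "g = (\<lambda>(e, fc, ab). face_entropy_production N (X e) w \<Psi> FEC fc ab
    (V e (face_node N fc ab)) (outer_value N glue orient V e fc ab))"
  define \<iota> where "\<iota> = (\<lambda>(e, fc, ab).
    (fst (glue (e, fc)), snd (glue (e, fc)), match_node N (orient (e, fc)) ab))"
  define P where "P = {1..KS} \<times> (UNIV :: face set) \<times> ({..N} \<times> {..N})"
  have in_P: "(e, fc, ab) \<in> P \<longleftrightarrow> e \<in> {1..KS} \<and> ab \<in> {..N} \<times> {..N}" for e fc ab
    unfolding P_def by blast
  have \<iota>_P: "\<iota> p \<in> P" if "p \<in> P" for p
    using that glue_range match_node_in_range by (cases p) (simp only: in_P \<iota>_def prod.case)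
  have \<iota>_\<iota>: "\<iota> (\<iota> p) = p" if "p \<in> P" for p
    using that by (cases p) (simp only: in_P \<iota>_def prod.case prod.collapse glue_invol orient_invol fst_conv snd_conv)
  have g_\<iota>: "g (\<iota> p) = - g p" if p: "p \<in> P" for p
  proof -
    obtain e fc ab where p': "p = (e, fc, ab)" by (cases p)
    have e: "e \<in> {1..KS}" and ab: "ab \<in> {..N} \<times> {..N}" using p by (simp_all only: in_P p')
    obtain e' fc' where glue: "glue (e, fc) = (e', fc')" by (cases "glue (e, fc)")
    define ab' where "ab' = match_node N (orient (e, fc)) ab"
    define a b where "a = V e (face_node N fc ab)" and "b = V e' (face_node N fc' ab')"
    have e': "e' \<in> {1..KS}" using glue_range[OF e, of fc] glue by simp
    have ab': "ab' \<in> {..N} \<times> {..N}" unfolding ab'_def using ab by (rule match_node_in_range)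
    have return: "glue (e', fc') = (e, fc)" "match_node N (orient (e', fc')) ab' = ab"
      using glue_invol[OF e, of fc] orient_invol[OF e ab, of fc] by (simp_all add: glue ab'_def)
    have AB: "a \<in> A" "b \<in> A" unfolding a_def b_def
      using V e e' ab ab' face_node_in_nodes by blast+
    have sn: "scaled_normal N (X e') fc' ab' = - scaled_normal N (X e) fc ab"
      unfolding ab'_def by (rule normals_agree[OF e glue ab])
    have fw: "face_weight N ab' = face_weight N ab"
      unfolding ab'_def by (rule face_weight_match_node[OF N ab])
    have jump: "w b \<bullet> FEC r b a - \<Psi> r b = w a \<bullet> FEC r a b - \<Psi> r a" for r
    proof -
      have "(w a - w b) \<bullet> FEC r a b = \<Psi> r a - \<Psi> r b" "FEC r b a = FEC r a b"
        using FEC[of r] AB by (auto simp: entropy_conservative_two_point_def)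
      then show ?thesis by (simp add: inner_diff_left)
    qed
    have "g p = face_weight N ab * (\<Sum>r\<in>UNIV. scaled_normal N (X e) fc ab $ r * (w a \<bullet> FEC r a b - \<Psi> r a))"
      by (simp add: g_def p' face_entropy_production_def outer_value_def glue a_def b_def ab'_def)
    moreover have "g (\<iota> p) = face_weight N ab' *
        (\<Sum>r\<in>UNIV. scaled_normal N (X e') fc' ab' $ r * (w b \<bullet> FEC r b a - \<Psi> r b))"
      unfolding g_def \<iota>_def p' using glue return
      by (simp add: face_entropy_production_def outer_value_def a_def b_def ab'_def[symmetric])
    ultimately show ?thesis by (simp add: sn fw jump sum_negf)
  qed
  have "(\<Sum>p\<in>P. g p) = (\<Sum>p\<in>P. g (\<iota> p))"
    by (rule sum.reindex_bij_witness[where i = \<iota> and j = \<iota>]) (auto simp: \<iota>_P \<iota>_\<iota>)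
  also have "\<dots> = - (\<Sum>p\<in>P. g p)" by (simp add: g_\<iota> sum_negf)
  finally have "(\<Sum>p\<in>P. g p) = 0" by simp
  then show ?thesis by (simp add: P_def g_def sum.cartesian_product split_beta)
qed

end

section \<open>Entropy preservation\<close>

text \<open>With \<open>H\<^sub>n\<close> and \<open>K\<^sub>n\<close> for the sums over all elements of \<open>w\<^sup>T U\<^sup>* - \<Phi>\<close> at the upper and the lower end of
  time slab \<open>n\<close>, the spatial cancellation gives \<open>H\<^sub>n = K\<^sub>n\<close> in each slab, and the condition on the
  interior states gives \<open>K\<^sub>n = H\<^sub>n\<^sub>-\<^sub>1\<close> across each interface. So \<open>H\<close> at the final time equals \<open>K\<close> at the
  initial time. The former is the final entropy; the latter differs from the initial entropy by the
  jump term because its \<open>w\<close> and \<open>\<Phi>\<close> are taken at the discrete solution, not at the initial data.\<close>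

theorem theorem2:
  fixes A :: "(real^'p) set"
    and f :: "3 \<Rightarrow> real^'p \<Rightarrow> real^'p"
    and s :: "real^'p \<Rightarrow> real"
    and w :: "real^'p \<Rightarrow> real^'p"
    and fs :: "3 \<Rightarrow> real^'p \<Rightarrow> real"
    and Uh :: "real^'p \<Rightarrow> real^'p \<Rightarrow> real^'p"
    and FEC :: "3 \<Rightarrow> real^'p \<Rightarrow> real^'p \<Rightarrow> real^'p"
    and N M KT KS :: nat
    and T :: real
    and dt :: "nat \<Rightarrow> real"
    and \<Omega> :: "(real^3) set"
    and X :: "nat \<Rightarrow> real^3 \<Rightarrow> real^3"
    and glue :: "nat \<times> face \<Rightarrow> nat \<times> face"
    and orient :: "nat \<times> face \<Rightarrow> orientation"
    and shift :: "nat \<times> face \<Rightarrow> real^3"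
    and u0 :: "nat \<Rightarrow> node \<Rightarrow> real^'p"
    and U :: "nat \<Rightarrow> nat \<Rightarrow> nat \<Rightarrow> node \<Rightarrow> real^'p"
    and Ustar :: "nat \<Rightarrow> nat \<Rightarrow> node \<Rightarrow> real^'p"
    and Fstar :: "nat \<Rightarrow> nat \<Rightarrow> face \<Rightarrow> nat \<Rightarrow> nat \<times> nat \<Rightarrow> real^'p"
  defines "\<Phi> \<equiv> entropy_potential w s"
    and "\<Psi> \<equiv> flux_potential w f fs"
  assumes degrees: "N \<ge> 1" "M \<ge> 1"
    and system: "entropy_system A f s w fs"
    and state_function: "entropy_conservative_two_point A w (\<lambda>a. a) \<Phi> Uh"
    and flux_functions: "\<And>m. entropy_conservative_two_point A w (f m) (\<Psi> m) (FEC m)"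
    and time_mesh: "KT \<ge> 1" "\<And>n. n \<in> {1..KT} \<Longrightarrow> dt n > 0" "(\<Sum>n = 1..KT. dt n) = T"
    and space_mesh: "periodic_mesh N KS \<Omega> X glue orient shift"
    and admissible: "\<And>n e \<sigma> x. \<lbrakk>n \<in> {1..KT}; e \<in> {1..KS}; \<sigma> \<le> M; x \<in> nodes N\<rbrakk> \<Longrightarrow> U n e \<sigma> x \<in> A"
    and admissible_initial: "\<And>e x. \<lbrakk>e \<in> {1..KS}; x \<in> nodes N\<rbrakk> \<Longrightarrow> u0 e x \<in> A"
    and solution: "space_time_dgsem N M KT KS dt X f Uh FEC Ustar Fstar U"
    and initial_state: "\<And>e x. \<lbrakk>e \<in> {1..KS}; x \<in> nodes N\<rbrakk> \<Longrightarrow> Ustar 0 e x = u0 e x"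
    and final_state: "\<And>e x. \<lbrakk>e \<in> {1..KS}; x \<in> nodes N\<rbrakk> \<Longrightarrow> Ustar KT e x = U KT e M x"
    and interior_states: "\<And>n e x. \<lbrakk>n \<in> {2..KT}; e \<in> {1..KS}; x \<in> nodes N\<rbrakk> \<Longrightarrow>
          time_jump M u0 U w n e x \<bullet> Ustar (n - 1) e x = time_jump M u0 U \<Phi> n e x"
    and surface_fluxes: "\<And>n e fc \<sigma> ab.
          \<lbrakk>n \<in> {1..KT}; e \<in> {1..KS}; \<sigma> \<le> M; ab \<in> {..N} \<times> {..N}\<rbrakk> \<Longrightarrow>
          Fstar n e fc \<sigma> ab =
            normal_flux N (X e) fc ab (\<lambda>m. FEC m (U n e \<sigma> (face_node N fc ab))
              (outer_value N glue orient (\<lambda>e. U n e \<sigma>) e fc ab))"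
  shows "0 = total_entropy N KS X s (\<lambda>e. U KT e M) - total_entropy N KS X s u0
           + (\<Sum>e = 1..KS. ip_space N
                (\<lambda>x. time_jump M u0 U \<Phi> 1 e x - time_jump M u0 U w 1 e x \<bullet> u0 e x) (jac N (X e)))"
proof -
  define H where "H n = (\<Sum>e = 1..KS. ip_space N
    (\<lambda>x. w (U n e M x) \<bullet> Ustar n e x - \<Phi> (U n e M x)) (jac N (X e)))" for n
  define K where "K n = (\<Sum>e = 1..KS. ip_space N
    (\<lambda>x. w (U n e 0 x) \<bullet> Ustar (n - 1) e x - \<Phi> (U n e 0 x)) (jac N (X e)))" for n
  interpret periodic_mesh N KS \<Omega> X glue orient shift by (rule space_mesh)

  have slab: "H n = K n" if n: "n \<in> {1..KT}" for n
  proof -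
    let ?W = "\<lambda>e \<sigma> x. w (U n e \<sigma> x)"
    let ?prod = "\<lambda>e \<sigma> fc ab. face_entropy_production N (X e) w \<Psi> FEC fc ab
      (U n e \<sigma> (face_node N fc ab)) (outer_value N glue orient (\<lambda>e. U n e \<sigma>) e fc ab)"
    have AT: "A_T N M (X e) Uh (U n e) (Ustar (n - 1) e) (Ustar n e) (?W e) =
        ip_space N (\<lambda>x. w (U n e M x) \<bullet> Ustar n e x - \<Phi> (U n e M x)) (jac N (X e))
        - ip_space N (\<lambda>x. w (U n e 0 x) \<bullet> Ustar (n - 1) e x - \<Phi> (U n e 0 x)) (jac N (X e))"
      if "e \<in> {1..KS}" for e
      by (rule A_T_entropy[OF degrees(2) state_function]) (use admissible n that in blast)
    have AS: "A_S N M (dt n) (X e) f FEC (U n e) (Fstar n e) (?W e) =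
        dt n / 2 * (\<Sum>\<sigma>\<le>M. lgl_weight M \<sigma> * (\<Sum>fc\<in>UNIV. \<Sum>ab\<in>{..N} \<times> {..N}. ?prod e \<sigma> fc ab))"
      if "e \<in> {1..KS}" for e
      by (rule A_S_entropy[OF degrees(1) flux_functions])
         (use admissible surface_fluxes n that in blast)+
    have cancel: "(\<Sum>e = 1..KS. \<Sum>fc\<in>UNIV. \<Sum>ab\<in>{..N} \<times> {..N}. ?prod e \<sigma> fc ab) = 0"
      if "\<sigma> \<le> M" for \<sigma>
      by (rule face_entropy_production_cancels[OF degrees(1) flux_functions])
         (use admissible n that in blast)
    have "0 = (\<Sum>e = 1..KS. A_T N M (X e) Uh (U n e) (Ustar (n - 1) e) (Ustar n e) (?W e)
        + A_S N M (dt n) (X e) f FEC (U n e) (Fstar n e) (?W e))"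
      using solution n by (simp add: space_time_dgsem_def)
    also have "\<dots> = H n - K n + (\<Sum>e = 1..KS. dt n / 2 * (\<Sum>\<sigma>\<le>M. lgl_weight M \<sigma> *
        (\<Sum>fc\<in>UNIV. \<Sum>ab\<in>{..N} \<times> {..N}. ?prod e \<sigma> fc ab)))"
      by (simp add: AT AS sum.distrib sum_subtractf H_def K_def del: One_nat_def)
    also have "(\<Sum>e = 1..KS. dt n / 2 * (\<Sum>\<sigma>\<le>M. lgl_weight M \<sigma> *
        (\<Sum>fc\<in>UNIV. \<Sum>ab\<in>{..N} \<times> {..N}. ?prod e \<sigma> fc ab))) =
      dt n / 2 * (\<Sum>\<sigma>\<le>M. lgl_weight M \<sigma> *
        (\<Sum>e = 1..KS. \<Sum>fc\<in>UNIV. \<Sum>ab\<in>{..N} \<times> {..N}. ?prod e \<sigma> fc ab))"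
      unfolding sum_distrib_left[of _ _ "{1..KS}", symmetric] sum.swap[of _ "{..M}" "{1..KS}"]
      by (simp only: sum_distrib_left[symmetric])
    also have "\<dots> = 0"
      by (simp add: cancel del: One_nat_def)
    finally show ?thesis by simp
  qed

  have interface: "K n = H (n - 1)" if n: "n \<in> {2..KT}" for n
    unfolding K_def H_def ip_space_def
  proof (intro sum.cong refl arg_cong2[where f = "(*)"] arg_cong2[where f = "(\<bullet>)"])
    fix e x assume "e \<in> {1..KS}" "x \<in> nodes N"
    then have "time_jump M u0 U w n e x \<bullet> Ustar (n - 1) e x = time_jump M u0 U \<Phi> n e x"
      using n by (intro interior_states)
    then show "w (U n e 0 x) \<bullet> Ustar (n - 1) e x - \<Phi> (U n e 0 x) =
        w (U (n - 1) e M x) \<bullet> Ustar (n - 1) e x - \<Phi> (U (n - 1) e M x)"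
      using n by (simp add: time_jump_def inner_diff_left)
  qed

  have "H n = K 1" if "1 \<le> n" "n \<le> KT" for n
    using that
  proof (induction n rule: dec_induct)
    case base
    then show ?case by (intro slab) simp
  next
    case (step n)
    then show ?case using slab[of "Suc n"] interface[of "Suc n"] by simp
  qed
  then have "H KT = K 1" using time_mesh(1) by simp
  moreover have "H KT = total_entropy N KS X s (\<lambda>e. U KT e M)"
    unfolding H_def total_entropy_def ip_space_def
    by (intro sum.cong refl) (simp add: final_state \<Phi>_def entropy_potential_def)
  moreover have "(\<Sum>e = 1..KS. ip_space N
      (\<lambda>x. time_jump M u0 U \<Phi> 1 e x - time_jump M u0 U w 1 e x \<bullet> u0 e x) (jac N (X e))) =
    total_entropy N KS X s u0 - K 1"
    unfolding K_def total_entropy_def ip_space_def sum_subtractf[symmetric]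
    by (intro sum.cong refl)
       (simp add: initial_state time_jump_def \<Phi>_def entropy_potential_def inner_diff_left algebra_simps)
  ultimately show ?thesis by simp
qed

end
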